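(* Let $\mathcal{M}$ be a model category and $\mathcal{C}$ a set of morphisms of $\mathcal{M}$ such that the left Bousfield localization $L_{\mathcal{C}}(\mathcal{M})$ exists and is a model category. Let $T$ be a monad on $\mathcal{M}$. If the categories of $T$-algebras in $\mathcal{M}$ and in $L_{\mathcal{C}}(\mathcal{M})$ inherit projective semi-model structures from $\mathcal{M}$ and $L_{\mathcal{C}}(\mathcal{M})$ respectively, then $L_{\mathcal{C}}$ preserves $T$-algebras.
   Context: Standing assumptions: $\mathcal{M}$ is left proper, model categories have functorial factorizations, $\mathcal{C}$ is a set of cofibrations between cofibrant objects, and $L_{\mathcal{C}}(\mathcal{M})$ exists and is a cofibrantly generated model category. $L_{\mathcal{C}}(\mathcal{M})$ is the model structure on the category $\mathcal{M}$ with the same cofibrations, whose weak equivalences are the $\mathcal{C}$-local equivalences, and whose fibrant objects are the $\mathcal{C}$-local objects: $N$ is $\mathcal{C}$-local if it is fibrant in $\mathcal{M}$ and $\mathrm{map}(g,N)$ is a weak equivalence of simplicial sets for all $g\in\mathcal{C}$; $f$ is a $\mathcal{C}$-local equivalence if $\mathrm{map}(f,N)$ is a weak equivalence for all $\mathcal{C}$-local $N$ ($\mathrm{map}$ is the homotopy mapping space). For $E\in\mathcal{M}$, $L_{\mathcal{C}}(E)$ denotes the image of $E$ under $\mathrm{Ho}(\mathcal{M})\to\mathrm{Ho}(L_{\mathcal{C}}(\mathcal{M}))\to\mathrm{Ho}(\mathcal{M})$ (derived functors of the identity), represented by $R_{\mathcal{C}}QE$, where $Q$ is cofibrant replacement in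 $\mathcal{M}$ and $R_{\mathcal{C}}$ is fibrant replacement in $L_{\mathcal{C}}(\mathcal{M})$; the localization map $E\to L_{\mathcal{C}}(E)$ is the unit of the adjunction $\mathrm{Ho}(\mathcal{M})\rightleftarrows\mathrm{Ho}(L_{\mathcal{C}}(\mathcal{M}))$. A monad on $\mathcal{M}$ is also a monad on $L_{\mathcal{C}}(\mathcal{M})$, since the underlying category is the same. $L_{\mathcal{C}}$ preserves $T$-algebras if: (1) for every $T$-algebra $E$ there is a $T$-algebra $\tilde E$ that is weakly equivalent in $\mathcal{M}$ to $L_{\mathcal{C}}(E)$; and (2) when $E$ is a cofibrant $T$-algebra (in the semi-model structure on $T$-algebras in $\mathcal{M}$), there is a natural choice of $\tilde E$ and a lift of the localization map $E\to L_{\mathcal{C}}(E)$ (a map in $\mathrm{Ho}(\mathcal{M})$) to a $T$-algebra homomorphism $E\to\tilde E$. $T$-algebras inherit a projective semi-model structure from a model category $\mathcal{N}$ if there is a semi-model structure on $T$-algebras, with respect to the free-forgetful adjunction, in which a map is a weak equivalence (resp. fibration) iff its underlying map in $\mathcal{N}$ is. Semi-model category: let $F:\mathcal{N}\rightleftarrows\mathcal{D}:U$ be an adjunction with $\mathcal{N}$ a cofibrantly generated model category, $\mathcal{D}$ bicomplete, and $U$ preserving colimits over non-empty ordinals. $\mathcal{D}$ is a semi-model category if it has classes of weak equivalences, fibrations and cofibrations such that: (i) $U$ preserves fibrations and trivial fibrations; (ii) the 2-out-of-3 and retract axioms hold; (iii) cofibrations have the left lifting property against trivial fibrations, and trivial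 cofibrations with cofibrant domain have the left lifting property against fibrations; (iv) every map functorially factors as a cofibration followed by a trivial fibration, and every map with cofibrant domain functorially factors as a trivial cofibration followed by a fibration; (v) the initial object is cofibrant; (vi) fibrations and trivial fibrations are closed under pullback. Trivial (co)fibrations are (co)fibrations that are weak equivalences; an object is cofibrant if the map from the initial object is a cofibration. *)

theory Defs
  imports "HOL-Homology.Simplices"
begin

section \<open>Categories\<close>

record ('o, 'm) cat =
  Obj :: "'o set"
  Arr :: "'m set"
  Dom :: "'m \<Rightarrow> 'o"
  Cod :: "'m \<Rightarrow> 'o"
  Idn :: "'o \<Rightarrow> 'm"
  Comp :: "'m \<Rightarrow> 'm \<Rightarrow> 'm"  (infixl "\<cdot>\<index>" 70)

definition homset :: "('o, 'm) cat \<Rightarrow> 'o \<Rightarrow> 'o \<Rightarrow> 'm set" where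
  "homset C X Y = {f \<in> Arr C. Dom C f = X \<and> Cod C f = Y}"

text \<open>Composition is written in the usual order: \<open>g \<cdot>\<^bsub>C\<^esub> f\<close> is \<open>f\<close> followed by \<open>g\<close>.
  Nothing is assumed about the operations outside the carriers.\<close>

definition category :: "('o, 'm) cat \<Rightarrow> bool" where
  "category C \<longleftrightarrow>
     (\<forall>f\<in>Arr C. Dom C f \<in> Obj C \<and> Cod C f \<in> Obj C) \<and>
     (\<forall>X\<in>Obj C. Idn C X \<in> homset C X X) \<and>
     (\<forall>f\<in>Arr C. \<forall>g\<in>Arr C. Cod C f = Dom C g \<longrightarrow> g \<cdot>\<^bsub>C\<^esub> f \<in> homset C (Dom C f) (Cod C g)) \<and>
     (\<forall>f\<in>Arr C. f \<cdot>\<^bsub>C\<^esub> Idn C (Dom C f) = f \<and> Idn C (Cod C f) \<cdot>\<^bsub>C\<^esub> f = f) \<and>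
     (\<forall>f\<in>Arr C. \<forall>g\<in>Arr C. \<forall>h\<in>Arr C. Cod C f = Dom C g \<longrightarrow> Cod C g = Dom C h \<longrightarrow>
        (h \<cdot>\<^bsub>C\<^esub> g) \<cdot>\<^bsub>C\<^esub> f = h \<cdot>\<^bsub>C\<^esub> (g \<cdot>\<^bsub>C\<^esub> f))"

definition iso_arr :: "('o, 'm) cat \<Rightarrow> 'm \<Rightarrow> bool" where
  "iso_arr C f \<longleftrightarrow> f \<in> Arr C \<and>
     (\<exists>g\<in>homset C (Cod C f) (Dom C f). g \<cdot>\<^bsub>C\<^esub> f = Idn C (Dom C f) \<and> f \<cdot>\<^bsub>C\<^esub> g = Idn C (Cod C f))"

definition full_subcat :: "('o, 'm) cat \<Rightarrow> 'o set \<Rightarrow> ('o, 'm) cat" where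
  "full_subcat C P = C\<lparr>Obj := Obj C \<inter> P, Arr := {f \<in> Arr C. Dom C f \<in> P \<and> Cod C f \<in> P}\<rparr>"

record ('o, 'm, 'p, 'n) func =
  fobj :: "'o \<Rightarrow> 'p"
  farr :: "'m \<Rightarrow> 'n"

definition is_functor :: "('o, 'm) cat \<Rightarrow> ('p, 'n) cat \<Rightarrow> ('o, 'm, 'p, 'n) func \<Rightarrow> bool" where
  "is_functor C D F \<longleftrightarrow> category C \<and> category D \<and>
     (\<forall>X\<in>Obj C. fobj F X \<in> Obj D) \<and>
     (\<forall>f\<in>Arr C. farr F f \<in> homset D (fobj F (Dom C f)) (fobj F (Cod C f))) \<and>
     (\<forall>X\<in>Obj C. farr F (Idn C X) = Idn D (fobj F X)) \<and>
     (\<forall>f\<in>Arr C. \<forall>g\<in>Arr C. Cod C f = Dom C g \<longrightarrow>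
        farr F (g \<cdot>\<^bsub>C\<^esub> f) = farr F g \<cdot>\<^bsub>D\<^esub> farr F f)"

definition id_func :: "('o, 'm, 'o, 'm) func" where
  "id_func = \<lparr>fobj = (\<lambda>X. X), farr = (\<lambda>f. f)\<rparr>"

definition comp_func :: "('p, 'n, 'q, 'k) func \<Rightarrow> ('o, 'm, 'p, 'n) func \<Rightarrow> ('o, 'm, 'q, 'k) func"
    (infixl "\<circ>\<^sub>F" 55) where
  "G \<circ>\<^sub>F F = \<lparr>fobj = fobj G \<circ> fobj F, farr = farr G \<circ> farr F\<rparr>"

definition const_func :: "('o, 'm) cat \<Rightarrow> 'o \<Rightarrow> ('i, 'j, 'o, 'm) func" where
  "const_func C X = \<lparr>fobj = (\<lambda>_. X), farr = (\<lambda>_. Idn C X)\<rparr>"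

definition nat_trans ::
    "('o, 'm) cat \<Rightarrow> ('p, 'n) cat \<Rightarrow> ('o, 'm, 'p, 'n) func \<Rightarrow> ('o, 'm, 'p, 'n) func \<Rightarrow> ('o \<Rightarrow> 'n) \<Rightarrow> bool"
  where
  "nat_trans C D F G \<tau> \<longleftrightarrow> is_functor C D F \<and> is_functor C D G \<and>
     (\<forall>X\<in>Obj C. \<tau> X \<in> homset D (fobj F X) (fobj G X)) \<and>
     (\<forall>f\<in>Arr C. \<tau> (Cod C f) \<cdot>\<^bsub>D\<^esub> farr F f = farr G f \<cdot>\<^bsub>D\<^esub> \<tau> (Dom C f))"

definition adjunction ::
    "('o, 'm) cat \<Rightarrow> ('p, 'n) cat \<Rightarrow> ('o, 'm, 'p, 'n) func \<Rightarrow> ('p, 'n, 'o, 'm) func \<Rightarrow> bool" where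
  "adjunction C D F U \<longleftrightarrow>
     (\<exists>\<eta> \<epsilon>. nat_trans C C id_func (U \<circ>\<^sub>F F) \<eta> \<and> nat_trans D D (F \<circ>\<^sub>F U) id_func \<epsilon> \<and>
        is_functor C D F \<and> is_functor D C U \<and>
        (\<forall>X\<in>Obj C. \<epsilon> (fobj F X) \<cdot>\<^bsub>D\<^esub> farr F (\<eta> X) = Idn D (fobj F X)) \<and>
        (\<forall>Y\<in>Obj D. farr U (\<epsilon> Y) \<cdot>\<^bsub>C\<^esub> \<eta> (fobj U Y) = Idn C (fobj U Y)))"


section \<open>Limits, colimits and size\<close>

definition is_initial :: "('o, 'm) cat \<Rightarrow> 'o \<Rightarrow> bool" where
  "is_initial C X \<longleftrightarrow> X \<in> Obj C \<and> (\<forall>Y\<in>Obj C. \<exists>!f. f \<in> homset C X Y)"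

definition is_terminal :: "('o, 'm) cat \<Rightarrow> 'o \<Rightarrow> bool" where
  "is_terminal C X \<longleftrightarrow> X \<in> Obj C \<and> (\<forall>Y\<in>Obj C. \<exists>!f. f \<in> homset C Y X)"

definition is_cocone ::
    "('i, 'j) cat \<Rightarrow> ('o, 'm) cat \<Rightarrow> ('i, 'j, 'o, 'm) func \<Rightarrow> 'o \<Rightarrow> ('i \<Rightarrow> 'm) \<Rightarrow> bool" where
  "is_cocone J C D X \<iota> \<longleftrightarrow> is_functor J C D \<and> X \<in> Obj C \<and>
     (\<forall>j\<in>Obj J. \<iota> j \<in> homset C (fobj D j) X) \<and>
     (\<forall>a\<in>Arr J. \<iota> (Cod J a) \<cdot>\<^bsub>C\<^esub> farr D a = \<iota> (Dom J a))"

definition is_colimit ::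
    "('i, 'j) cat \<Rightarrow> ('o, 'm) cat \<Rightarrow> ('i, 'j, 'o, 'm) func \<Rightarrow> 'o \<Rightarrow> ('i \<Rightarrow> 'm) \<Rightarrow> bool" where
  "is_colimit J C D X \<iota> \<longleftrightarrow> is_cocone J C D X \<iota> \<and>
     (\<forall>Y \<nu>. is_cocone J C D Y \<nu> \<longrightarrow>
        (\<exists>!h. h \<in> homset C X Y \<and> (\<forall>j\<in>Obj J. h \<cdot>\<^bsub>C\<^esub> \<iota> j = \<nu> j)))"

definition is_cone ::
    "('i, 'j) cat \<Rightarrow> ('o, 'm) cat \<Rightarrow> ('i, 'j, 'o, 'm) func \<Rightarrow> 'o \<Rightarrow> ('i \<Rightarrow> 'm) \<Rightarrow> bool" where
  "is_cone J C D X \<pi> \<longleftrightarrow> is_functor J C D \<and> X \<in> Obj C \<and>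
     (\<forall>j\<in>Obj J. \<pi> j \<in> homset C X (fobj D j)) \<and>
     (\<forall>a\<in>Arr J. farr D a \<cdot>\<^bsub>C\<^esub> \<pi> (Dom J a) = \<pi> (Cod J a))"

definition is_limit ::
    "('i, 'j) cat \<Rightarrow> ('o, 'm) cat \<Rightarrow> ('i, 'j, 'o, 'm) func \<Rightarrow> 'o \<Rightarrow> ('i \<Rightarrow> 'm) \<Rightarrow> bool" where
  "is_limit J C D X \<pi> \<longleftrightarrow> is_cone J C D X \<pi> \<and>
     (\<forall>Y \<nu>. is_cone J C D Y \<nu> \<longrightarrow>
        (\<exists>!h. h \<in> homset C Y X \<and> (\<forall>j\<in>Obj J. \<pi> j \<cdot>\<^bsub>C\<^esub> h = \<nu> j)))"

text \<open>The square with \<open>f : A \<rightarrow> B\<close>, \<open>g : A \<rightarrow> D\<close>, \<open>i : B \<rightarrow> P\<close>, \<open>j : D \<rightarrow> P\<close> is a pushout;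
  \<open>j\<close> is the pushout of \<open>f\<close> along \<open>g\<close>.\<close>

definition is_pushout :: "('o, 'm) cat \<Rightarrow> 'm \<Rightarrow> 'm \<Rightarrow> 'm \<Rightarrow> 'm \<Rightarrow> bool" where
  "is_pushout C f g i j \<longleftrightarrow> {f, g, i, j} \<subseteq> Arr C \<and>
     Dom C f = Dom C g \<and> Dom C i = Cod C f \<and> Dom C j = Cod C g \<and> Cod C i = Cod C j \<and>
     i \<cdot>\<^bsub>C\<^esub> f = j \<cdot>\<^bsub>C\<^esub> g \<and>
     (\<forall>u\<in>Arr C. \<forall>v\<in>Arr C. Dom C u = Cod C f \<longrightarrow> Dom C v = Cod C g \<longrightarrow> Cod C u = Cod C v \<longrightarrow>
        u \<cdot>\<^bsub>C\<^esub> f = v \<cdot>\<^bsub>C\<^esub> g \<longrightarrow>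
        (\<exists>!h. h \<in> homset C (Cod C i) (Cod C u) \<and> h \<cdot>\<^bsub>C\<^esub> i = u \<and> h \<cdot>\<^bsub>C\<^esub> j = v))"

text \<open>The square with \<open>f : B \<rightarrow> A\<close>, \<open>g : D \<rightarrow> A\<close>, \<open>i : P \<rightarrow> B\<close>, \<open>j : P \<rightarrow> D\<close> is a pullback;
  \<open>j\<close> is the pullback of \<open>f\<close> along \<open>g\<close>.\<close>

definition is_pullback :: "('o, 'm) cat \<Rightarrow> 'm \<Rightarrow> 'm \<Rightarrow> 'm \<Rightarrow> 'm \<Rightarrow> bool" where
  "is_pullback C f g i j \<longleftrightarrow> {f, g, i, j} \<subseteq> Arr C \<and>
     Cod C f = Cod C g \<and> Cod C i = Dom C f \<and> Cod C j = Dom C g \<and> Dom C i = Dom C j \<and>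
     f \<cdot>\<^bsub>C\<^esub> i = g \<cdot>\<^bsub>C\<^esub> j \<and>
     (\<forall>u\<in>Arr C. \<forall>v\<in>Arr C. Cod C u = Dom C f \<longrightarrow> Cod C v = Dom C g \<longrightarrow> Dom C u = Dom C v \<longrightarrow>
        f \<cdot>\<^bsub>C\<^esub> u = g \<cdot>\<^bsub>C\<^esub> v \<longrightarrow>
        (\<exists>!h. h \<in> homset C (Dom C u) (Dom C i) \<and> i \<cdot>\<^bsub>C\<^esub> h = u \<and> j \<cdot>\<^bsub>C\<^esub> h = v))"

text \<open>``Small'' refers to a universe, given by a regular strong limit cardinal \<open>\<kappa>\<close>: a set is small
  if its cardinality is below \<open>\<kappa>\<close>. For uncountable \<open>\<kappa>\<close> these are the Grothendieck universes;
  \<open>\<aleph>\<^sub>0\<close> is not excluded. Every small set is in bijection with a subset of \<open>'u\<close>, so that small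
  index categories and small ordinals can be taken with carriers in \<open>'u\<close>.\<close>

definition universe :: "'u rel \<Rightarrow> bool" where
  "universe \<kappa> \<longleftrightarrow> Card_order \<kappa> \<and> cinfinite \<kappa> \<and> regularCard \<kappa> \<and>
     (\<forall>A :: 'u set. (card_of A, \<kappa>) \<in> ordLess \<longrightarrow> (card_of (Pow A), \<kappa>) \<in> ordLess)"

definition small :: "'u rel \<Rightarrow> 'a set \<Rightarrow> bool" where
  "small \<kappa> A \<longleftrightarrow> (card_of A, \<kappa>) \<in> ordLess"

definition locally_small :: "'u rel \<Rightarrow> ('o, 'm) cat \<Rightarrow> bool" where
  "locally_small \<kappa> C \<longleftrightarrow> (\<forall>X\<in>Obj C. \<forall>Y\<in>Obj C. small \<kappa> (homset C X Y))"

definition bicomplete :: "'u rel \<Rightarrow> ('o, 'm) cat \<Rightarrow> bool" where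
  "bicomplete \<kappa> C \<longleftrightarrow>
     (\<forall>(J :: ('u, 'u) cat) D. category J \<longrightarrow> small \<kappa> (Obj J) \<longrightarrow> small \<kappa> (Arr J) \<longrightarrow>
        is_functor J C D \<longrightarrow> (\<exists>X \<pi>. is_limit J C D X \<pi>) \<and> (\<exists>X \<iota>. is_colimit J C D X \<iota>))"


section \<open>Transfinite compositions\<close>

definition poset_cat :: "'u rel \<Rightarrow> ('u, 'u \<times> 'u) cat" where
  "poset_cat r = \<lparr>Obj = Field r, Arr = r, Dom = fst, Cod = snd, Idn = (\<lambda>i. (i, i)),
     Comp = (\<lambda>b a. (fst a, snd b))\<rparr>"

definition nonempty_ordinal :: "'u rel \<Rightarrow> 'u rel \<Rightarrow> bool" where
  "nonempty_ordinal \<kappa> r \<longleftrightarrow> Well_order r \<and> Field r \<noteq> {} \<and> small \<kappa> (Field r)"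

definition is_least :: "'u rel \<Rightarrow> 'u \<Rightarrow> bool" where
  "is_least r z \<longleftrightarrow> z \<in> Field r \<and> (\<forall>i\<in>Field r. (z, i) \<in> r)"

definition is_succ :: "'u rel \<Rightarrow> 'u \<Rightarrow> 'u \<Rightarrow> bool" where
  "is_succ r i j \<longleftrightarrow> (i, j) \<in> r \<and> i \<noteq> j \<and> (\<forall>k. (i, k) \<in> r \<longrightarrow> (k, j) \<in> r \<longrightarrow> k = i \<or> k = j)"

definition is_limit_elem :: "'u rel \<Rightarrow> 'u \<Rightarrow> bool" where
  "is_limit_elem r l \<longleftrightarrow> l \<in> Field r \<and> underS r l \<noteq> {} \<and>
     (\<forall>i\<in>underS r l. \<exists>j\<in>underS r l. (i, j) \<in> r \<and> i \<noteq> j)"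

text \<open>A \<open>\<lambda>\<close>-sequence of maps in \<open>P\<close>: a functor from the ordinal \<open>r\<close> that preserves the colimits
  at limit stages and whose successor maps lie in \<open>P\<close>.\<close>

definition lambda_sequence ::
    "('o, 'm) cat \<Rightarrow> 'm set \<Rightarrow> 'u rel \<Rightarrow> ('u, 'u \<times> 'u, 'o, 'm) func \<Rightarrow> bool" where
  "lambda_sequence C P r X \<longleftrightarrow> is_functor (poset_cat r) C X \<and>
     (\<forall>l. is_limit_elem r l \<longrightarrow>
        is_colimit (poset_cat (Restr r (underS r l))) C X (fobj X l) (\<lambda>i. farr X (i, l))) \<and>
     (\<forall>i j. is_succ r i j \<longrightarrow> farr X (i, j) \<in> P)"

definition transfinite_comps :: "'u rel \<Rightarrow> ('o, 'm) cat \<Rightarrow> 'm set \<Rightarrow> 'm set" where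
  "transfinite_comps \<kappa> C P = {f. \<exists>(r :: 'u rel) X Y \<iota> z. nonempty_ordinal \<kappa> r \<and>
     lambda_sequence C P r X \<and> is_colimit (poset_cat r) C X Y \<iota> \<and> is_least r z \<and> f = \<iota> z}"

definition rel_cell :: "'u rel \<Rightarrow> ('o, 'm) cat \<Rightarrow> 'm set \<Rightarrow> 'm set" where
  "rel_cell \<kappa> C I = transfinite_comps \<kappa> C {j. \<exists>f\<in>I. \<exists>g i. is_pushout C f g i j}"

text \<open>\<open>r\<close> is \<open>k\<close>-filtered: a limit ordinal in which every subset of cardinality at most \<open>k\<close> has
  its supremum below the top.\<close>

definition filtered_ordinal :: "'u rel \<Rightarrow> 'u rel \<Rightarrow> bool" where
  "filtered_ordinal k r \<longleftrightarrow> (\<forall>i\<in>Field r. \<exists>j. (i, j) \<in> r \<and> i \<noteq> j) \<and>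
     (\<forall>A \<subseteq> Field r. (card_of A, k) \<in> ordLeq \<longrightarrow> (\<exists>b\<in>Field r. \<forall>a\<in>A. (a, b) \<in> r))"

text \<open>The last two conjuncts say that the canonical map from the colimit over \<open>i\<close> of the sets
  \<open>homset C A (fobj X i)\<close> to \<open>homset C A Y\<close> is surjective and injective.\<close>

definition small_relative :: "'u rel \<Rightarrow> ('o, 'm) cat \<Rightarrow> 'm set \<Rightarrow> 'o \<Rightarrow> bool" where
  "small_relative \<kappa> C P A \<longleftrightarrow> A \<in> Obj C \<and>
     (\<exists>k :: 'u rel. Card_order k \<and> (k, \<kappa>) \<in> ordLess \<and>
        (\<forall>(r :: 'u rel) X Y \<iota>. nonempty_ordinal \<kappa> r \<longrightarrow> filtered_ordinal k r \<longrightarrow>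
           lambda_sequence C P r X \<longrightarrow> is_colimit (poset_cat r) C X Y \<iota> \<longrightarrow>
           (\<forall>f\<in>homset C A Y. \<exists>i\<in>Field r. \<exists>g\<in>homset C A (fobj X i). f = \<iota> i \<cdot>\<^bsub>C\<^esub> g) \<and>
           (\<forall>i\<in>Field r. \<forall>i'\<in>Field r. \<forall>g\<in>homset C A (fobj X i). \<forall>g'\<in>homset C A (fobj X i').
              \<iota> i \<cdot>\<^bsub>C\<^esub> g = \<iota> i' \<cdot>\<^bsub>C\<^esub> g' \<longrightarrow>
              (\<exists>j\<in>Field r. (i, j) \<in> r \<and> (i', j) \<in> r \<and>
                 farr X (i, j) \<cdot>\<^bsub>C\<^esub> g = farr X (i', j) \<cdot>\<^bsub>C\<^esub> g'))))"


section \<open>Model categories\<close>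

record 'm mstruct =
  weq :: "'m set"
  fib :: "'m set"
  cof :: "'m set"

definition two_of_three :: "('o, 'm) cat \<Rightarrow> 'm set \<Rightarrow> bool" where
  "two_of_three C W \<longleftrightarrow>
     (\<forall>f\<in>Arr C. \<forall>g\<in>Arr C. Cod C f = Dom C g \<longrightarrow>
        (f \<in> W \<longrightarrow> g \<in> W \<longrightarrow> g \<cdot>\<^bsub>C\<^esub> f \<in> W) \<and>
        (f \<in> W \<longrightarrow> g \<cdot>\<^bsub>C\<^esub> f \<in> W \<longrightarrow> g \<in> W) \<and>
        (g \<in> W \<longrightarrow> g \<cdot>\<^bsub>C\<^esub> f \<in> W \<longrightarrow> f \<in> W))"

definition arrow_retract :: "('o, 'm) cat \<Rightarrow> 'm \<Rightarrow> 'm \<Rightarrow> bool" where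
  "arrow_retract C f g \<longleftrightarrow> f \<in> Arr C \<and> g \<in> Arr C \<and>
     (\<exists>i\<in>homset C (Dom C f) (Dom C g). \<exists>i'\<in>homset C (Cod C f) (Cod C g).
      \<exists>r\<in>homset C (Dom C g) (Dom C f). \<exists>r'\<in>homset C (Cod C g) (Cod C f).
        g \<cdot>\<^bsub>C\<^esub> i = i' \<cdot>\<^bsub>C\<^esub> f \<and> f \<cdot>\<^bsub>C\<^esub> r = r' \<cdot>\<^bsub>C\<^esub> g \<and>
        r \<cdot>\<^bsub>C\<^esub> i = Idn C (Dom C f) \<and> r' \<cdot>\<^bsub>C\<^esub> i' = Idn C (Cod C f))"

definition retract_closed :: "('o, 'm) cat \<Rightarrow> 'm set \<Rightarrow> bool" where
  "retract_closed C P \<longleftrightarrow> (\<forall>f g. g \<in> P \<longrightarrow> arrow_retract C f g \<longrightarrow> f \<in> P)"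

text \<open>\<open>f\<close> has the left lifting property against \<open>p\<close>.\<close>

definition lifts :: "('o, 'm) cat \<Rightarrow> 'm \<Rightarrow> 'm \<Rightarrow> bool" where
  "lifts C f p \<longleftrightarrow>
     (\<forall>u\<in>homset C (Dom C f) (Dom C p). \<forall>v\<in>homset C (Cod C f) (Cod C p).
        p \<cdot>\<^bsub>C\<^esub> u = v \<cdot>\<^bsub>C\<^esub> f \<longrightarrow>
        (\<exists>h\<in>homset C (Cod C f) (Dom C p). h \<cdot>\<^bsub>C\<^esub> f = u \<and> p \<cdot>\<^bsub>C\<^esub> h = v))"

text \<open>The category of arrows of \<open>C\<close> lying in \<open>P\<close>; a morphism \<open>(f, g, u, v)\<close> from \<open>f\<close> to \<open>g\<close> is a
  commutative square with top \<open>u\<close> and bottom \<open>v\<close>.\<close>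

definition arrow_cat :: "('o, 'm) cat \<Rightarrow> 'm set \<Rightarrow> ('m, 'm \<times> 'm \<times> 'm \<times> 'm) cat" where
  "arrow_cat C P = \<lparr>Obj = Arr C \<inter> P,
     Arr = {(f, g, u, v). f \<in> Arr C \<inter> P \<and> g \<in> Arr C \<inter> P \<and> u \<in> homset C (Dom C f) (Dom C g) \<and>
              v \<in> homset C (Cod C f) (Cod C g) \<and> g \<cdot>\<^bsub>C\<^esub> u = v \<cdot>\<^bsub>C\<^esub> f},
     Dom = (\<lambda>(f, g, u, v). f), Cod = (\<lambda>(f, g, u, v). g),
     Idn = (\<lambda>f. (f, f, Idn C (Dom C f), Idn C (Cod C f))),
     Comp = (\<lambda>(f', g', u', v') (f, g, u, v). (f, g', u' \<cdot>\<^bsub>C\<^esub> u, v' \<cdot>\<^bsub>C\<^esub> v))\<rparr>"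

definition dom_func :: "('o, 'm) cat \<Rightarrow> ('m, 'm \<times> 'm \<times> 'm \<times> 'm, 'o, 'm) func" where
  "dom_func C = \<lparr>fobj = Dom C, farr = (\<lambda>(f, g, u, v). u)\<rparr>"

definition cod_func :: "('o, 'm) cat \<Rightarrow> ('m, 'm \<times> 'm \<times> 'm \<times> 'm, 'o, 'm) func" where
  "cod_func C = \<lparr>fobj = Cod C, farr = (\<lambda>(f, g, u, v). v)\<rparr>"

definition functorial_factorization ::
    "('o, 'm) cat \<Rightarrow> 'm set \<Rightarrow> 'm set \<Rightarrow> 'm set \<Rightarrow> bool" where
  "functorial_factorization C P L R \<longleftrightarrow>
     (\<exists>Z l r. nat_trans (arrow_cat C P) C (dom_func C) Z l \<and>
        nat_trans (arrow_cat C P) C Z (cod_func C) r \<and>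
        (\<forall>f\<in>Arr C \<inter> P. l f \<in> L \<and> r f \<in> R \<and> r f \<cdot>\<^bsub>C\<^esub> l f = f))"

definition model_category :: "'u rel \<Rightarrow> ('o, 'm) cat \<Rightarrow> 'm mstruct \<Rightarrow> bool" where
  "model_category \<kappa> C S \<longleftrightarrow>
     category C \<and> locally_small \<kappa> C \<and> bicomplete \<kappa> C \<and>
     weq S \<subseteq> Arr C \<and> fib S \<subseteq> Arr C \<and> cof S \<subseteq> Arr C \<and>
     two_of_three C (weq S) \<and>
     retract_closed C (weq S) \<and> retract_closed C (fib S) \<and> retract_closed C (cof S) \<and>
     (\<forall>i\<in>cof S. \<forall>p\<in>fib S \<inter> weq S. lifts C i p) \<and>
     (\<forall>i\<in>cof S \<inter> weq S. \<forall>p\<in>fib S. lifts C i p) \<and>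
     functorial_factorization C UNIV (cof S) (fib S \<inter> weq S) \<and>
     functorial_factorization C UNIV (cof S \<inter> weq S) (fib S)"

definition cofibrant :: "('o, 'm) cat \<Rightarrow> 'm mstruct \<Rightarrow> 'o \<Rightarrow> bool" where
  "cofibrant C S X \<longleftrightarrow> X \<in> Obj C \<and> (\<exists>Z f. is_initial C Z \<and> f \<in> homset C Z X \<and> f \<in> cof S)"

definition fibrant :: "('o, 'm) cat \<Rightarrow> 'm mstruct \<Rightarrow> 'o \<Rightarrow> bool" where
  "fibrant C S X \<longleftrightarrow> X \<in> Obj C \<and> (\<exists>Z f. is_terminal C Z \<and> f \<in> homset C X Z \<and> f \<in> fib S)"

definition left_proper :: "('o, 'm) cat \<Rightarrow> 'm mstruct \<Rightarrow> bool" where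
  "left_proper C S \<longleftrightarrow>
     (\<forall>f g i j. is_pushout C f g i j \<longrightarrow> f \<in> weq S \<longrightarrow> g \<in> cof S \<longrightarrow> j \<in> weq S)"

definition cofibrantly_generated :: "'u rel \<Rightarrow> ('o, 'm) cat \<Rightarrow> 'm mstruct \<Rightarrow> bool" where
  "cofibrantly_generated \<kappa> C S \<longleftrightarrow>
     (\<exists>I J. I \<subseteq> Arr C \<and> J \<subseteq> Arr C \<and> small \<kappa> I \<and> small \<kappa> J \<and>
        (\<forall>i\<in>I. small_relative \<kappa> C (rel_cell \<kappa> C I) (Dom C i)) \<and>
        (\<forall>j\<in>J. small_relative \<kappa> C (rel_cell \<kappa> C J) (Dom C j)) \<and>
        fib S \<inter> weq S = {p \<in> Arr C. \<forall>i\<in>I. lifts C i p} \<and>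
        fib S = {p \<in> Arr C. \<forall>j\<in>J. lifts C j p})"

definition cofibrant_replacement ::
    "('o, 'm) cat \<Rightarrow> 'm mstruct \<Rightarrow> ('o, 'm, 'o, 'm) func \<Rightarrow> ('o \<Rightarrow> 'm) \<Rightarrow> bool" where
  "cofibrant_replacement C S Q q \<longleftrightarrow> nat_trans C C Q id_func q \<and>
     (\<forall>X\<in>Obj C. cofibrant C S (fobj Q X) \<and> q X \<in> fib S \<inter> weq S)"

definition fibrant_replacement ::
    "('o, 'm) cat \<Rightarrow> 'm mstruct \<Rightarrow> ('o, 'm, 'o, 'm) func \<Rightarrow> ('o \<Rightarrow> 'm) \<Rightarrow> bool" where
  "fibrant_replacement C S R r \<longleftrightarrow> nat_trans C C id_func R r \<and>
     (\<forall>X\<in>Obj C. fibrant C S (fobj R X) \<and> r X \<in> cof S \<inter> weq S)"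

definition weakly_equivalent :: "('o, 'm) cat \<Rightarrow> 'm mstruct \<Rightarrow> 'o \<Rightarrow> 'o \<Rightarrow> bool" where
  "weakly_equivalent C S X Y \<longleftrightarrow> X \<in> Obj C \<and> Y \<in> Obj C \<and>
     (X, Y) \<in> (\<Union>w\<in>weq S. {(Dom C w, Cod C w), (Cod C w, Dom C w)})\<^sup>*"


section \<open>Homotopy categories\<close>

text \<open>The homotopy category is the localization of \<open>C\<close> at the weak equivalences: its morphisms are
  zigzags, in which \<open>Bwd w\<close> is a weak equivalence \<open>w\<close> traversed backwards, modulo the congruence
  generated by functoriality of \<open>Fwd\<close> and by \<open>Bwd w\<close> being inverse to \<open>Fwd w\<close>.
  Zigzags are read from left to right.\<close>

datatype 'm step = Fwd 'm | Bwd 'm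

fun zigzag :: "('o, 'm) cat \<Rightarrow> 'm mstruct \<Rightarrow> 'o \<Rightarrow> 'm step list \<Rightarrow> 'o \<Rightarrow> bool" where
  "zigzag C S X [] Y \<longleftrightarrow> X \<in> Obj C \<and> X = Y"
| "zigzag C S X (Fwd f # p) Y \<longleftrightarrow> f \<in> Arr C \<and> Dom C f = X \<and> zigzag C S (Cod C f) p Y"
| "zigzag C S X (Bwd w # p) Y \<longleftrightarrow> w \<in> Arr C \<and> w \<in> weq S \<and> Cod C w = X \<and> zigzag C S (Dom C w) p Y"

inductive zz_step :: "('o, 'm) cat \<Rightarrow> 'm mstruct \<Rightarrow> 'm step list \<Rightarrow> 'm step list \<Rightarrow> bool"
  for C S where
  "X \<in> Obj C \<Longrightarrow> zz_step C S [Fwd (Idn C X)] []"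
| "f \<in> Arr C \<Longrightarrow> g \<in> Arr C \<Longrightarrow> Cod C f = Dom C g \<Longrightarrow> zz_step C S [Fwd f, Fwd g] [Fwd (g \<cdot>\<^bsub>C\<^esub> f)]"
| "w \<in> weq S \<Longrightarrow> zz_step C S [Fwd w, Bwd w] []"
| "w \<in> weq S \<Longrightarrow> zz_step C S [Bwd w, Fwd w] []"

definition zz_rel :: "('o, 'm) cat \<Rightarrow> 'm mstruct \<Rightarrow> 'o \<Rightarrow> 'o \<Rightarrow> 'm step list rel" where
  "zz_rel C S X Y = {(p @ a @ q, p @ b @ q) | p q a b.
     zz_step C S a b \<and> zigzag C S X (p @ a @ q) Y \<and> zigzag C S X (p @ b @ q) Y}"

definition zz_class ::
    "('o, 'm) cat \<Rightarrow> 'm mstruct \<Rightarrow> 'o \<Rightarrow> 'm step list \<Rightarrow> 'o \<Rightarrow> 'o \<times> 'o \<times> 'm step list set" where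
  "zz_class C S X p Y = (X, Y, {q. (p, q) \<in> (zz_rel C S X Y \<union> (zz_rel C S X Y)\<inverse>)\<^sup>*})"

text \<open>In a triple \<open>(X, Y, c)\<close> the class \<open>c\<close> is nonempty, and the union over its representatives
  is a union of equal sets.\<close>

definition Ho :: "('o, 'm) cat \<Rightarrow> 'm mstruct \<Rightarrow> ('o, 'o \<times> 'o \<times> 'm step list set) cat" where
  "Ho C S = \<lparr>Obj = Obj C, Arr = {zz_class C S X p Y | X p Y. zigzag C S X p Y},
     Dom = fst, Cod = (\<lambda>(X, Y, c). Y), Idn = (\<lambda>X. zz_class C S X [] X),
     Comp = (\<lambda>(Y', Z, d) (X, Y, c). (X, Z, \<Union>p\<in>c. \<Union>q\<in>d. snd (snd (zz_class C S X (p @ q) Z))))\<rparr>"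

definition ho_proj :: "('o, 'm) cat \<Rightarrow> 'm mstruct \<Rightarrow> ('o, 'm, 'o, 'o \<times> 'o \<times> 'm step list set) func" where
  "ho_proj C S = \<lparr>fobj = (\<lambda>X. X), farr = (\<lambda>f. zz_class C S (Dom C f) [Fwd f] (Cod C f))\<rparr>"

text \<open>The functor from a homotopy category to \<open>Ho D S'\<close> induced by a functor \<open>F\<close> that sends weak
  equivalences to weak equivalences.\<close>

definition ho_map ::
    "('p, 'n) cat \<Rightarrow> 'n mstruct \<Rightarrow> ('o, 'm, 'p, 'n) func \<Rightarrow>
     ('o, 'o \<times> 'o \<times> 'm step list set, 'p, 'p \<times> 'p \<times> 'n step list set) func" where
  "ho_map D S' F = \<lparr>fobj = fobj F,
     farr = (\<lambda>(X, Y, c). (fobj F X, fobj F Y,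
        \<Union>p\<in>c. snd (snd (zz_class D S' (fobj F X) (map (map_step (farr F)) p) (fobj F Y)))))\<rparr>"


section \<open>Simplicial sets and their weak equivalences\<close>

text \<open>A morphism \<open>(m, n, xs)\<close> of the simplex category is the monotone map \<open>[m] \<rightarrow> [n]\<close> whose list of
  values is \<open>xs\<close>.\<close>

type_synonym smap = "nat \<times> nat \<times> nat list"

definition simplex_cat :: "(nat, smap) cat" where
  "simplex_cat = \<lparr>Obj = UNIV,
     Arr = {(m, n, xs). length xs = Suc m \<and> sorted xs \<and> set xs \<subseteq> {..n}},
     Dom = fst, Cod = (\<lambda>(m, n, xs). n), Idn = (\<lambda>n. (n, n, [0..<Suc n])),
     Comp = (\<lambda>(n', k, ys) (m, n, xs). (m, k, map ((!) ys) xs))\<rparr>"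

abbreviation "simplex_arrs \<equiv> Arr simplex_cat"
abbreviation "sdom \<equiv> Dom simplex_cat"
abbreviation "scod \<equiv> Cod simplex_cat"

definition sval :: "smap \<Rightarrow> nat \<Rightarrow> nat" where
  "sval \<alpha> i = snd (snd \<alpha>) ! i"

record 'a sset =
  simp :: "nat \<Rightarrow> 'a set"
  act :: "smap \<Rightarrow> 'a \<Rightarrow> 'a"

definition is_sset :: "'a sset \<Rightarrow> bool" where
  "is_sset K \<longleftrightarrow>
     (\<forall>\<alpha>\<in>simplex_arrs. \<forall>x\<in>simp K (scod \<alpha>). act K \<alpha> x \<in> simp K (sdom \<alpha>)) \<and>
     (\<forall>n. \<forall>x\<in>simp K n. act K (Idn simplex_cat n) x = x) \<and>
     (\<forall>\<alpha>\<in>simplex_arrs. \<forall>\<beta>\<in>simplex_arrs. scod \<alpha> = sdom \<beta> \<longrightarrow>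
        (\<forall>x\<in>simp K (scod \<beta>). act K (\<beta> \<cdot>\<^bsub>simplex_cat\<^esub> \<alpha>) x = act K \<alpha> (act K \<beta> x)))"

definition is_sset_map :: "'a sset \<Rightarrow> 'b sset \<Rightarrow> (nat \<Rightarrow> 'a \<Rightarrow> 'b) \<Rightarrow> bool" where
  "is_sset_map K L f \<longleftrightarrow> is_sset K \<and> is_sset L \<and>
     (\<forall>n. \<forall>x\<in>simp K n. f n x \<in> simp L n) \<and>
     (\<forall>\<alpha>\<in>simplex_arrs. \<forall>x\<in>simp K (scod \<alpha>). f (sdom \<alpha>) (act K \<alpha> x) = act L \<alpha> (f (scod \<alpha>) x))"

text \<open>Geometric realization: the quotient of the disjoint union of the spaces
  \<open>simp K n \<times> standard_simplex n\<close> (with \<open>simp K n\<close> discrete) by the gluing relation.\<close>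

definition push_simplex :: "smap \<Rightarrow> (nat \<Rightarrow> real) \<Rightarrow> nat \<Rightarrow> real" where
  "push_simplex \<alpha> t = (\<lambda>j. \<Sum>i | i \<le> sdom \<alpha> \<and> sval \<alpha> i = j. t i)"

definition real_points :: "'a sset \<Rightarrow> (nat \<times> 'a \<times> (nat \<Rightarrow> real)) set" where
  "real_points K = {(n, x, t). x \<in> simp K n \<and> t \<in> standard_simplex n}"

definition glue :: "'a sset \<Rightarrow> (nat \<times> 'a \<times> (nat \<Rightarrow> real)) rel" where
  "glue K = {((sdom \<alpha>, act K \<alpha> x, t), (scod \<alpha>, x, push_simplex \<alpha> t)) | \<alpha> x t.
     \<alpha> \<in> simplex_arrs \<and> x \<in> simp K (scod \<alpha>) \<and> t \<in> standard_simplex (sdom \<alpha>)}"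

definition real_class ::
    "'a sset \<Rightarrow> nat \<times> 'a \<times> (nat \<Rightarrow> real) \<Rightarrow> (nat \<times> 'a \<times> (nat \<Rightarrow> real)) set" where
  "real_class K p = {q. (p, q) \<in> (glue K \<union> (glue K)\<inverse>)\<^sup>*}"

definition realization :: "'a sset \<Rightarrow> (nat \<times> 'a \<times> (nat \<Rightarrow> real)) set topology" where
  "realization K = topology (\<lambda>U. U \<subseteq> real_class K ` real_points K \<and>
     (\<forall>n. \<forall>x\<in>simp K n.
        openin (subtopology (powertop_real UNIV) (standard_simplex n))
          {t \<in> standard_simplex n. real_class K (n, x, t) \<in> U}))"

lemma openin_realization:
  "openin (realization K) U \<longleftrightarrow> U \<subseteq> real_class K ` real_points K \<and>
     (\<forall>n. \<forall>x\<in>simp K n.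
        openin (subtopology (powertop_real UNIV) (standard_simplex n))
          {t \<in> standard_simplex n. real_class K (n, x, t) \<in> U})"
proof -
  define T where "T n = subtopology (powertop_real UNIV) (standard_simplex n)" for n
  define s where "s n x U = {t \<in> standard_simplex n. real_class K (n, x, t) \<in> U}" for n x U
  define P where "P U \<longleftrightarrow> U \<subseteq> real_class K ` real_points K \<and> (\<forall>n. \<forall>x\<in>simp K n. openin (T n) (s n x U))" for U
  have "P (A \<inter> B)" if "P A" "P B" for A B
  proof -
    have "s n x (A \<inter> B) = s n x A \<inter> s n x B" for n x by (auto simp: s_def)
    then show ?thesis using that unfolding P_def by (simp add: openin_Int le_infI1)
  qed
  moreover have "P (\<Union>\<U>)" if "\<forall>A\<in>\<U>. P A" for \<U>
  proof -
    have "s n x (\<Union>\<U>) = \<Union>(s n x ` \<U>)" for n x by (auto simp: s_def)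
    then show ?thesis using that unfolding P_def by (auto intro!: openin_Union)
  qed
  ultimately have "istopology P" unfolding istopology_def by blast
  moreover have "realization K = topology P"
    unfolding realization_def P_def s_def T_def by simp
  ultimately show ?thesis by (simp add: topology_inverse' P_def s_def T_def)
qed

definition real_map ::
    "'b sset \<Rightarrow> (nat \<Rightarrow> 'a \<Rightarrow> 'b) \<Rightarrow>
     (nat \<times> 'a \<times> (nat \<Rightarrow> real)) set \<Rightarrow> (nat \<times> 'b \<times> (nat \<Rightarrow> real)) set" where
  "real_map L f c = (\<Union>(n, x, t)\<in>c. real_class L (n, f n x, t))"

definition sphere_base :: "nat \<Rightarrow> real" where
  "sphere_base = (\<lambda>i. if i = 0 then 1 else 0)"

definition pointed_homotopic :: "nat \<Rightarrow> 'a topology \<Rightarrow> 'a \<Rightarrow> ((nat \<Rightarrow> real) \<Rightarrow> 'a) \<Rightarrow> ((nat \<Rightarrow> real) \<Rightarrow> 'a) \<Rightarrow> bool"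
  where
  "pointed_homotopic n X x = homotopic_with (\<lambda>h. h sphere_base = x) (nsphere n) X"

text \<open>The set \<open>\<pi>\<^sub>n(X, x)\<close> of pointed homotopy classes of pointed maps from the \<open>n\<close>-sphere;
  for \<open>n = 0\<close> these are the path components of \<open>X\<close>.\<close>

definition homotopy_set :: "nat \<Rightarrow> 'a topology \<Rightarrow> 'a \<Rightarrow> ((nat \<Rightarrow> real) \<Rightarrow> 'a) set set" where
  "homotopy_set n X x = {{h. pointed_homotopic n X x g h} | g.
     continuous_map (nsphere n) X g \<and> g sphere_base = x}"

definition homotopy_set_map ::
    "nat \<Rightarrow> 'b topology \<Rightarrow> 'b \<Rightarrow> ('a \<Rightarrow> 'b) \<Rightarrow> ((nat \<Rightarrow> real) \<Rightarrow> 'a) set \<Rightarrow> ((nat \<Rightarrow> real) \<Rightarrow> 'b) set" where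
  "homotopy_set_map n Y y f c = (\<Union>g\<in>c. {h. pointed_homotopic n Y y (f \<circ> g) h})"

definition weak_homotopy_equivalence :: "'a topology \<Rightarrow> 'b topology \<Rightarrow> ('a \<Rightarrow> 'b) \<Rightarrow> bool" where
  "weak_homotopy_equivalence X Y f \<longleftrightarrow> continuous_map X Y f \<and>
     (topspace X = {} \<longrightarrow> topspace Y = {}) \<and>
     (\<forall>n. \<forall>x\<in>topspace X.
        bij_betw (homotopy_set_map n Y (f x) f) (homotopy_set n X x) (homotopy_set n Y (f x)))"

definition sset_weak_equivalence :: "'a sset \<Rightarrow> 'b sset \<Rightarrow> (nat \<Rightarrow> 'a \<Rightarrow> 'b) \<Rightarrow> bool" where
  "sset_weak_equivalence K L f \<longleftrightarrow> is_sset_map K L f \<and>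
     weak_homotopy_equivalence (realization K) (realization L) (real_map L f)"


section \<open>Homotopy mapping spaces and left Bousfield localization\<close>

text \<open>The latching category at \<open>n\<close> of the simplex category: its objects are the injective
  non-identity maps into \<open>[n]\<close>; a morphism \<open>(\<tau>, \<sigma>, \<sigma>')\<close> is an injective map \<open>\<tau>\<close> over \<open>[n]\<close> from
  \<open>\<sigma>\<close> to \<open>\<sigma>'\<close>.\<close>

definition injective_smaps :: "smap set" where
  "injective_smaps = {\<alpha> \<in> simplex_arrs. distinct (snd (snd \<alpha>))}"

definition latching_cat :: "nat \<Rightarrow> (smap, smap \<times> smap \<times> smap) cat" where
  "latching_cat n = (let P = {\<sigma> \<in> injective_smaps. scod \<sigma> = n \<and> sdom \<sigma> < n} in
     \<lparr>Obj = P,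
      Arr = {(\<tau>, \<sigma>, \<sigma>'). \<tau> \<in> injective_smaps \<and> \<sigma> \<in> P \<and> \<sigma>' \<in> P \<and>
               sdom \<tau> = sdom \<sigma> \<and> scod \<tau> = sdom \<sigma>' \<and> \<sigma>' \<cdot>\<^bsub>simplex_cat\<^esub> \<tau> = \<sigma>},
      Dom = (\<lambda>(\<tau>, \<sigma>, \<sigma>'). \<sigma>), Cod = (\<lambda>(\<tau>, \<sigma>, \<sigma>'). \<sigma>'),
      Idn = (\<lambda>\<sigma>. (Idn simplex_cat (sdom \<sigma>), \<sigma>, \<sigma>)),
      Comp = (\<lambda>(\<tau>', \<sigma>1, \<sigma>2) (\<tau>, \<sigma>, \<sigma>'). (\<tau>' \<cdot>\<^bsub>simplex_cat\<^esub> \<tau>, \<sigma>, \<sigma>2))\<rparr>)"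

definition latching_forget :: "(smap, smap \<times> smap \<times> smap, nat, smap) func" where
  "latching_forget = \<lparr>fobj = sdom, farr = fst\<rparr>"

text \<open>\<open>h\<close> is the latching map at \<open>n\<close>.\<close>

definition reedy_cofibrant ::
    "('o, 'm) cat \<Rightarrow> 'm mstruct \<Rightarrow> (nat, smap, 'o, 'm) func \<Rightarrow> bool" where
  "reedy_cofibrant C S A \<longleftrightarrow> is_functor simplex_cat C A \<and>
     (\<forall>n. \<exists>L \<iota>. is_colimit (latching_cat n) C (A \<circ>\<^sub>F latching_forget) L \<iota> \<and>
        (\<exists>h\<in>homset C L (fobj A n). h \<in> cof S \<and>
           (\<forall>\<sigma>\<in>Obj (latching_cat n). h \<cdot>\<^bsub>C\<^esub> \<iota> \<sigma> = farr A \<sigma>)))"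

definition cosimplicial_resolution ::
    "('o, 'm) cat \<Rightarrow> 'm mstruct \<Rightarrow> 'o \<Rightarrow> (nat, smap, 'o, 'm) func \<Rightarrow> (nat \<Rightarrow> 'm) \<Rightarrow> bool" where
  "cosimplicial_resolution C S X A e \<longleftrightarrow> X \<in> Obj C \<and> reedy_cofibrant C S A \<and>
     nat_trans simplex_cat C A (const_func C X) e \<and> (\<forall>n. e n \<in> weq S)"

definition mapping_sset :: "('o, 'm) cat \<Rightarrow> (nat, smap, 'o, 'm) func \<Rightarrow> 'o \<Rightarrow> 'm sset" where
  "mapping_sset C A N = \<lparr>simp = (\<lambda>n. homset C (fobj A n) N), act = (\<lambda>\<alpha> g. g \<cdot>\<^bsub>C\<^esub> farr A \<alpha>)\<rparr>"

text \<open>The homotopy mapping space \<open>map(X, N)\<close> is the simplicial set of maps from a cosimplicial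
  resolution of \<open>X\<close> to a fibrant approximation of \<open>N\<close>; a map \<open>f : X \<rightarrow> Y\<close>, lifted to a map \<open>\<phi>\<close> of
  resolutions, induces \<open>map(f, N)\<close> by precomposition. The homotopy type of this map does not
  depend on the choices.\<close>

definition map_weak_equivalence :: "('o, 'm) cat \<Rightarrow> 'm mstruct \<Rightarrow> 'm \<Rightarrow> 'o \<Rightarrow> bool" where
  "map_weak_equivalence C S f N \<longleftrightarrow> f \<in> Arr C \<and>
     (\<exists>A a B b \<phi> j.
        cosimplicial_resolution C S (Dom C f) A a \<and> cosimplicial_resolution C S (Cod C f) B b \<and>
        nat_trans simplex_cat C A B \<phi> \<and> (\<forall>n. b n \<cdot>\<^bsub>C\<^esub> \<phi> n = f \<cdot>\<^bsub>C\<^esub> a n) \<and>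
        j \<in> weq S \<and> Dom C j = N \<and> fibrant C S (Cod C j) \<and>
        sset_weak_equivalence (mapping_sset C B (Cod C j)) (mapping_sset C A (Cod C j))
          (\<lambda>n g. g \<cdot>\<^bsub>C\<^esub> \<phi> n))"

definition local_object :: "('o, 'm) cat \<Rightarrow> 'm mstruct \<Rightarrow> 'm set \<Rightarrow> 'o \<Rightarrow> bool" where
  "local_object C S \<C> N \<longleftrightarrow> fibrant C S N \<and> (\<forall>g\<in>\<C>. map_weak_equivalence C S g N)"

definition local_equivalence :: "('o, 'm) cat \<Rightarrow> 'm mstruct \<Rightarrow> 'm set \<Rightarrow> 'm \<Rightarrow> bool" where
  "local_equivalence C S \<C> f \<longleftrightarrow> f \<in> Arr C \<and>
     (\<forall>N. local_object C S \<C> N \<longrightarrow> map_weak_equivalence C S f N)"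

definition left_bousfield_localization ::
    "'u rel \<Rightarrow> ('o, 'm) cat \<Rightarrow> 'm mstruct \<Rightarrow> 'm set \<Rightarrow> 'm mstruct \<Rightarrow> bool" where
  "left_bousfield_localization \<kappa> C S \<C> S' \<longleftrightarrow> model_category \<kappa> C S' \<and>
     cof S' = cof S \<and>
     weq S' = {f. local_equivalence C S \<C> f} \<and>
     (\<forall>N. fibrant C S' N \<longleftrightarrow> local_object C S \<C> N)"

text \<open>The composite \<open>Ho C S \<rightarrow> Ho C S' \<rightarrow> Ho C S\<close> of the left derived functor of the identity, computed
  by a cofibrant replacement \<open>Q\<close> for \<open>S\<close>, and the right derived functor of the identity, computed
  by a fibrant replacement \<open>R\<close> for the localized structure \<open>S'\<close>.\<close>

definition localization_functor ::
    "('o, 'm) cat \<Rightarrow> 'm mstruct \<Rightarrow> 'm mstruct \<Rightarrow> ('o, 'm, 'o, 'm) func \<Rightarrow> ('o, 'm, 'o, 'm) func \<Rightarrow>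
     ('o, 'o \<times> 'o \<times> 'm step list set, 'o, 'o \<times> 'o \<times> 'm step list set) func" where
  "localization_functor C S S' Q R = ho_map C S R \<circ>\<^sub>F ho_map C S' Q"

text \<open>The unit of the derived adjunction is represented by \<open>X \<leftarrow> Q X \<rightarrow> R (Q X)\<close>.\<close>

definition localization_map ::
    "('o, 'm) cat \<Rightarrow> 'm mstruct \<Rightarrow> ('o, 'm, 'o, 'm) func \<Rightarrow> ('o \<Rightarrow> 'm) \<Rightarrow>
     ('o, 'm, 'o, 'm) func \<Rightarrow> ('o \<Rightarrow> 'm) \<Rightarrow> 'o \<Rightarrow> 'o \<times> 'o \<times> 'm step list set" where
  "localization_map C S Q q R r X =
     zz_class C S X [Bwd (q X), Fwd (r (fobj Q X))] (fobj R (fobj Q X))"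


section \<open>Monads, algebras and semi-model structures\<close>

record ('o, 'm) monad =
  mfun :: "('o, 'm, 'o, 'm) func"
  munit :: "'o \<Rightarrow> 'm"
  mmult :: "'o \<Rightarrow> 'm"

definition is_monad :: "('o, 'm) cat \<Rightarrow> ('o, 'm) monad \<Rightarrow> bool" where
  "is_monad C T \<longleftrightarrow>
     nat_trans C C id_func (mfun T) (munit T) \<and>
     nat_trans C C (mfun T \<circ>\<^sub>F mfun T) (mfun T) (mmult T) \<and>
     (\<forall>X\<in>Obj C.
        mmult T X \<cdot>\<^bsub>C\<^esub> munit T (fobj (mfun T) X) = Idn C (fobj (mfun T) X) \<and>
        mmult T X \<cdot>\<^bsub>C\<^esub> farr (mfun T) (munit T X) = Idn C (fobj (mfun T) X) \<and>
        mmult T X \<cdot>\<^bsub>C\<^esub> mmult T (fobj (mfun T) X) = mmult T X \<cdot>\<^bsub>C\<^esub> farr (mfun T) (mmult T X))"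

type_synonym ('o, 'm) alg = "'o \<times> 'm"
type_synonym ('o, 'm) alg_arr = "('o \<times> 'm) \<times> ('o \<times> 'm) \<times> 'm"

definition algebras :: "('o, 'm) cat \<Rightarrow> ('o, 'm) monad \<Rightarrow> ('o, 'm) alg set" where
  "algebras C T = {(X, a). X \<in> Obj C \<and> a \<in> homset C (fobj (mfun T) X) X \<and>
     a \<cdot>\<^bsub>C\<^esub> munit T X = Idn C X \<and> a \<cdot>\<^bsub>C\<^esub> mmult T X = a \<cdot>\<^bsub>C\<^esub> farr (mfun T) a}"

definition alg_cat :: "('o, 'm) cat \<Rightarrow> ('o, 'm) monad \<Rightarrow> (('o, 'm) alg, ('o, 'm) alg_arr) cat" where
  "alg_cat C T = \<lparr>Obj = algebras C T,
     Arr = {(E, E', f). E \<in> algebras C T \<and> E' \<in> algebras C T \<and> f \<in> homset C (fst E) (fst E') \<and>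
              f \<cdot>\<^bsub>C\<^esub> snd E = snd E' \<cdot>\<^bsub>C\<^esub> farr (mfun T) f},
     Dom = fst, Cod = (\<lambda>(E, E', f). E'), Idn = (\<lambda>E. (E, E, Idn C (fst E))),
     Comp = (\<lambda>(E1, E2, g) (E, E', f). (E, E2, g \<cdot>\<^bsub>C\<^esub> f))\<rparr>"

definition forget_func :: "(('o, 'm) alg, ('o, 'm) alg_arr, 'o, 'm) func" where
  "forget_func = \<lparr>fobj = fst, farr = (\<lambda>(E, E', f). f)\<rparr>"

definition free_func ::
    "('o, 'm) cat \<Rightarrow> ('o, 'm) monad \<Rightarrow> ('o, 'm, ('o, 'm) alg, ('o, 'm) alg_arr) func" where
  "free_func C T = (let F = (\<lambda>X. (fobj (mfun T) X, mmult T X)) in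
     \<lparr>fobj = F, farr = (\<lambda>f. (F (Dom C f), F (Cod C f), farr (mfun T) f))\<rparr>)"

definition preserves_ordinal_colimits ::
    "'u rel \<Rightarrow> ('p, 'n) cat \<Rightarrow> ('o, 'm) cat \<Rightarrow> ('p, 'n, 'o, 'm) func \<Rightarrow> bool" where
  "preserves_ordinal_colimits \<kappa> D C U \<longleftrightarrow>
     (\<forall>(r :: 'u rel) X Y \<iota>. nonempty_ordinal \<kappa> r \<longrightarrow> is_colimit (poset_cat r) D X Y \<iota> \<longrightarrow>
        is_colimit (poset_cat r) C (U \<circ>\<^sub>F X) (fobj U Y) (farr U \<circ> \<iota>))"

definition semi_model_category ::
    "'u rel \<Rightarrow> ('o, 'm) cat \<Rightarrow> 'm mstruct \<Rightarrow> ('p, 'n) cat \<Rightarrow>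
     ('o, 'm, 'p, 'n) func \<Rightarrow> ('p, 'n, 'o, 'm) func \<Rightarrow> 'n mstruct \<Rightarrow> bool" where
  "semi_model_category \<kappa> C S D F U A \<longleftrightarrow>
     model_category \<kappa> C S \<and> cofibrantly_generated \<kappa> C S \<and>
     category D \<and> bicomplete \<kappa> D \<and> adjunction C D F U \<and> preserves_ordinal_colimits \<kappa> D C U \<and>
     weq A \<subseteq> Arr D \<and> fib A \<subseteq> Arr D \<and> cof A \<subseteq> Arr D \<and>
     farr U ` fib A \<subseteq> fib S \<and> farr U ` (fib A \<inter> weq A) \<subseteq> fib S \<inter> weq S \<and>
     two_of_three D (weq A) \<and>
     retract_closed D (weq A) \<and> retract_closed D (fib A) \<and> retract_closed D (cof A) \<and>
     (\<forall>i\<in>cof A. \<forall>p\<in>fib A \<inter> weq A. lifts D i p) \<and>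
     (\<forall>i\<in>cof A \<inter> weq A. cofibrant D A (Dom D i) \<longrightarrow> (\<forall>p\<in>fib A. lifts D i p)) \<and>
     functorial_factorization D UNIV (cof A) (fib A \<inter> weq A) \<and>
     functorial_factorization D {f. cofibrant D A (Dom D f)} (cof A \<inter> weq A) (fib A) \<and>
     (\<forall>X. is_initial D X \<longrightarrow> cofibrant D A X) \<and>
     (\<forall>f g i j. is_pullback D f g i j \<longrightarrow> f \<in> fib A \<longrightarrow> j \<in> fib A) \<and>
     (\<forall>f g i j. is_pullback D f g i j \<longrightarrow> f \<in> fib A \<inter> weq A \<longrightarrow> j \<in> fib A \<inter> weq A)"

definition projective_semi_model_structure ::
    "'u rel \<Rightarrow> ('o, 'm) cat \<Rightarrow> 'm mstruct \<Rightarrow> ('o, 'm) monad \<Rightarrow> ('o, 'm) alg_arr mstruct \<Rightarrow> bool" where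
  "projective_semi_model_structure \<kappa> C S T A \<longleftrightarrow>
     semi_model_category \<kappa> C S (alg_cat C T) (free_func C T) forget_func A \<and>
     weq A = {f \<in> Arr (alg_cat C T). farr forget_func f \<in> weq S} \<and>
     fib A = {f \<in> Arr (alg_cat C T). farr forget_func f \<in> fib S}"


section \<open>Preservation of algebras\<close>

text \<open>In the second clause, \<open>G\<close> is the natural choice of an algebra for cofibrant \<open>E\<close>, \<open>\<rho>\<close> is the
  homomorphism \<open>E \<rightarrow> G E\<close>, and \<open>\<beta>\<close> is the natural isomorphism in \<open>Ho C S\<close> that identifies \<open>G E\<close> with
  the localization of \<open>E\<close> and under which \<open>\<rho>\<close> becomes the localization map. Cofibrancy refers to
  the semi-model structure \<open>A\<close> on algebras over the unlocalized \<open>C\<close>, \<open>S\<close>.\<close>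

definition preserves_algebras ::
    "('o, 'm) cat \<Rightarrow> 'm mstruct \<Rightarrow> 'm mstruct \<Rightarrow> ('o, 'm, 'o, 'm) func \<Rightarrow> ('o \<Rightarrow> 'm) \<Rightarrow>
     ('o, 'm, 'o, 'm) func \<Rightarrow> ('o \<Rightarrow> 'm) \<Rightarrow> ('o, 'm) monad \<Rightarrow> ('o, 'm) alg_arr mstruct \<Rightarrow> bool" where
  "preserves_algebras C S S' Q q R r T A \<longleftrightarrow>
     (let Alg = alg_cat C T;
          U = forget_func;
          Loc = localization_functor C S S' Q R;
          CofAlg = full_subcat Alg {E. cofibrant Alg A E}
      in
       (\<forall>E\<in>Obj Alg. \<exists>E'\<in>Obj Alg. weakly_equivalent C S (fobj U E') (fobj Loc (fobj U E))) \<and>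
       (\<exists>G \<rho> \<beta>.
          nat_trans CofAlg Alg id_func G \<rho> \<and>
          nat_trans CofAlg (Ho C S) (ho_proj C S \<circ>\<^sub>F U \<circ>\<^sub>F G) (Loc \<circ>\<^sub>F ho_proj C S \<circ>\<^sub>F U) \<beta> \<and>
          (\<forall>E\<in>Obj CofAlg.
             weakly_equivalent C S (fobj U (fobj G E)) (fobj Loc (fobj U E)) \<and>
             iso_arr (Ho C S) (\<beta> E) \<and>
             \<beta> E \<cdot>\<^bsub>Ho C S\<^esub> farr (ho_proj C S \<circ>\<^sub>F U) (\<rho> E) = localization_map C S Q q R r (fobj U E))))"

end

theory Submission
  imports Defs
begin

text \<open>
  The projective structures on algebras over \<open>S\<close> and over its localization \<open>S\<^sub>L\<close> have the same
  cofibrations: cofibrations are the maps that lift against trivial fibrations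
  (\<open>semi_model_cof_iff\<close>), and trivial fibrations of algebras are detected in \<open>S\<close> and in
  \<open>S\<^sub>L\<close>, where they agree because both are determined by the common class of cofibrations
  (\<open>tfib_eq\<close>). An algebra \<open>E\<close> that is cofibrant over \<open>S\<close> is therefore also cofibrant over
  \<open>S\<^sub>L\<close>, and the restricted factorization axiom of the localized semi-model structure, applied to
  the maps from cofibrant algebras to the terminal algebra, gives a functorial fibrant replacement
  \<open>\<rho> E : E \<rightarrow> G E\<close> (\<open>functorial_replacement\<close>). Its underlying map is a local equivalence
  into a local object, so it has to be the localization of the object underlying \<open>E\<close>.

  For a local equivalence \<open>g : X \<rightarrow> Y\<close> into a local object this is made precise by the zigzag
  \<open>Y \<leftarrow> Q Y \<rightarrow> R (Q Y) \<leftarrow> R (Q X)\<close> (\<open>comparison\<close>), which consists of weak equivalences of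
  \<open>S\<close>, is natural in \<open>g\<close>, and turns \<open>g\<close> into the unit \<open>X \<leftarrow> Q X \<rightarrow> R (Q X)\<close> of the derived
  adjunction. With \<open>g\<close> the map underlying \<open>\<rho> E\<close> this is the second clause of the theorem. For the
  first clause, an arbitrary algebra \<open>E\<close> is replaced by a cofibrant one along a trivial
  fibration, which \<open>R \<circ> Q\<close> sends to a weak equivalence.

  Two facts about the localization make the zigzag work. Weak equivalences are local equivalences
  (\<open>weq_local_equivalence\<close>), so that \<open>Q\<close> followed by \<open>R\<close> is defined on homotopy categories;
  and local equivalences between local objects are weak equivalences
  (\<open>weq_between_fibrant\<close>), which is a lifting argument with a path object that serves both model
  structures.
\<close>


section \<open>Arrows and objects\<close>

lemma homsetI: "f \<in> Arr C \<Longrightarrow> Dom C f = X \<Longrightarrow> Cod C f = Y \<Longrightarrow> f \<in> homset C X Y"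
  by (simp add: homset_def)

lemma homsetD:
  assumes "f \<in> homset C X Y"
  shows "f \<in> Arr C" "Dom C f = X" "Cod C f = Y"
  using assms by (auto simp: homset_def)

lemma homset_Obj:
  assumes "category C" "f \<in> homset C X Y"
  shows "X \<in> Obj C" "Y \<in> Obj C"
  using assms by (auto simp: homset_def category_def)

lemma comp_homset:
  assumes "category C" "f \<in> homset C X Y" "g \<in> homset C Y Z"
  shows "g \<cdot>\<^bsub>C\<^esub> f \<in> homset C X Z"
  using assms unfolding homset_def category_def by auto

lemma Idn_homset: "category C \<Longrightarrow> X \<in> Obj C \<Longrightarrow> Idn C X \<in> homset C X X"
  unfolding category_def by auto

lemma comp_Idn:
  assumes "category C" "f \<in> homset C X Y"
  shows "f \<cdot>\<^bsub>C\<^esub> Idn C X = f" "Idn C Y \<cdot>\<^bsub>C\<^esub> f = f"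
  using assms unfolding homset_def category_def by auto

lemma comp_assoc:
  assumes "category C" "f \<in> homset C W X" "g \<in> homset C X Y" "h \<in> homset C Y Z"
  shows "(h \<cdot>\<^bsub>C\<^esub> g) \<cdot>\<^bsub>C\<^esub> f = h \<cdot>\<^bsub>C\<^esub> (g \<cdot>\<^bsub>C\<^esub> f)"
  using assms unfolding homset_def category_def by auto

lemma functor_homset:
  assumes "is_functor C D F" "f \<in> homset C X Y"
  shows "farr F f \<in> homset D (fobj F X) (fobj F Y)"
  using assms unfolding homset_def is_functor_def by auto

lemma functor_Obj: "is_functor C D F \<Longrightarrow> X \<in> Obj C \<Longrightarrow> fobj F X \<in> Obj D"
  unfolding is_functor_def by auto

lemma functor_Idn: "is_functor C D F \<Longrightarrow> X \<in> Obj C \<Longrightarrow> farr F (Idn C X) = Idn D (fobj F X)"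
  unfolding is_functor_def by auto

lemma functor_comp:
  assumes "is_functor C D F" "f \<in> homset C X Y" "g \<in> homset C Y Z"
  shows "farr F (g \<cdot>\<^bsub>C\<^esub> f) = farr F g \<cdot>\<^bsub>D\<^esub> farr F f"
  using assms unfolding homset_def is_functor_def by auto

lemma functorI:
  assumes "category C" "category D" "\<And>X. X \<in> Obj C \<Longrightarrow> fobj F X \<in> Obj D"
    and "\<And>f X Y. f \<in> homset C X Y \<Longrightarrow> farr F f \<in> homset D (fobj F X) (fobj F Y)"
    and "\<And>X. X \<in> Obj C \<Longrightarrow> farr F (Idn C X) = Idn D (fobj F X)"
    and "\<And>f g X Y Z. f \<in> homset C X Y \<Longrightarrow> g \<in> homset C Y Z \<Longrightarrow>
      farr F (g \<cdot>\<^bsub>C\<^esub> f) = farr F g \<cdot>\<^bsub>D\<^esub> farr F f"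
  shows "is_functor C D F"
  using assms unfolding is_functor_def by (auto simp: homset_def)

lemma comp_functor:
  assumes "is_functor C D F" "is_functor D E G"
  shows "is_functor C E (G \<circ>\<^sub>F F)"
proof (rule functorI)
  show "category C" "category E" using assms by (auto simp: is_functor_def)
qed (auto simp: comp_func_def intro: functor_Obj functor_homset assms
      simp: functor_Idn[OF assms(1)] functor_Idn[OF assms(2)] functor_Obj[OF assms(1)]
      functor_comp[OF assms(1)] functor_comp[OF assms(2) functor_homset[OF assms(1)] functor_homset[OF assms(1)]])

lemma nat_trans_homset: "nat_trans C D F G \<tau> \<Longrightarrow> X \<in> Obj C \<Longrightarrow> \<tau> X \<in> homset D (fobj F X) (fobj G X)"
  unfolding nat_trans_def by auto

lemma nat_trans_square:
  assumes "nat_trans C D F G \<tau>" "f \<in> homset C X Y"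
  shows "\<tau> Y \<cdot>\<^bsub>D\<^esub> farr F f = farr G f \<cdot>\<^bsub>D\<^esub> \<tau> X"
  using assms unfolding homset_def nat_trans_def by auto

lemma nat_transI:
  assumes "is_functor C D F" "is_functor C D G"
    and "\<And>X. X \<in> Obj C \<Longrightarrow> \<tau> X \<in> homset D (fobj F X) (fobj G X)"
    and "\<And>f X Y. f \<in> homset C X Y \<Longrightarrow> \<tau> Y \<cdot>\<^bsub>D\<^esub> farr F f = farr G f \<cdot>\<^bsub>D\<^esub> \<tau> X"
  shows "nat_trans C D F G \<tau>"
  using assms unfolding nat_trans_def by (auto simp: homset_def)

lemma full_subcat_Obj: "X \<in> Obj (full_subcat C P) \<longleftrightarrow> X \<in> Obj C \<and> X \<in> P"
  by (auto simp: full_subcat_def)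

lemma full_subcat_homset:
  "f \<in> homset (full_subcat C P) X Y \<longleftrightarrow> f \<in> homset C X Y \<and> X \<in> P \<and> Y \<in> P"
  by (auto simp: full_subcat_def homset_def)

lemma full_subcat_ops:
  "Idn (full_subcat C P) = Idn C" "Comp (full_subcat C P) = Comp C"
  "Dom (full_subcat C P) = Dom C" "Cod (full_subcat C P) = Cod C"
  by (auto simp: full_subcat_def)

lemma category_full_subcat: "category C \<Longrightarrow> category (full_subcat C P)"
  unfolding category_def full_subcat_def homset_def by auto

lemma functor_full_subcat:
  assumes "is_functor C D F"
  shows "is_functor (full_subcat C P) D F"
proof (rule functorI)
  show "category (full_subcat C P)" "category D"
    using assms category_full_subcat by (auto simp: is_functor_def)
qed (auto simp: full_subcat_Obj full_subcat_homset full_subcat_ops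
      intro: functor_Obj[OF assms] functor_homset[OF assms] functor_Idn[OF assms] functor_comp[OF assms])


section \<open>Terminal objects and products\<close>

lemma universe_infinite:
  assumes "universe (\<kappa> :: 'u rel)"
  shows "infinite (UNIV :: 'u set)"
  using assms unfolding universe_def cinfinite_def
  by (meson finite_subset subset_UNIV)

lemma small_finite:
  assumes "universe (\<kappa> :: 'u rel)" "finite A"
  shows "small \<kappa> A"
proof -
  have k: "Card_order \<kappa>" "infinite (Field \<kappa>)"
    using assms(1) unfolding universe_def cinfinite_def by auto
  have "Well_order \<kappa>" using k(1) unfolding card_order_on_def by (rule conjunct1)
  moreover have "finite (Field (card_of A))" using assms(2) by (simp only: Field_card_of)
  ultimately show ?thesis
    unfolding small_def by (rule finite_ordLess_infinite[OF card_of_Well_order _ _ k(2)])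
qed

text \<open>Index categories have to live on the type \<open>'u\<close> that carries the universe. As that type is
  infinite, finite discrete diagrams can be indexed by subsets of it, which gives terminal and
  initial objects and binary products.\<close>

definition discrete_cat :: "'u set \<Rightarrow> ('u, 'u) cat" where
  "discrete_cat A = \<lparr>Obj = A, Arr = A, Dom = (\<lambda>x. x), Cod = (\<lambda>x. x), Idn = (\<lambda>x. x), Comp = (\<lambda>g f. f)\<rparr>"

lemma category_discrete_cat: "category (discrete_cat A)"
  by (auto simp: category_def discrete_cat_def homset_def)

lemma functor_discrete_cat:
  assumes "category C" "\<And>x. x \<in> A \<Longrightarrow> X x \<in> Obj C"
  shows "is_functor (discrete_cat A) C \<lparr>fobj = X, farr = \<lambda>x. Idn C (X x)\<rparr>"
  using assms Idn_homset[OF assms(1)] comp_Idn(1)[OF assms(1) Idn_homset[OF assms(1)]]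
  by (auto simp: is_functor_def category_discrete_cat) (auto simp: discrete_cat_def)

lemma cone_discrete_cat:
  assumes "category C" "\<And>x. x \<in> A \<Longrightarrow> X x \<in> Obj C"
  shows "is_cone (discrete_cat A) C \<lparr>fobj = X, farr = \<lambda>x. Idn C (X x)\<rparr> P \<pi> \<longleftrightarrow>
    P \<in> Obj C \<and> (\<forall>x\<in>A. \<pi> x \<in> homset C P (X x))"
  using functor_discrete_cat[OF assms] comp_Idn(2)[OF assms(1)]
  unfolding is_cone_def by (auto simp: discrete_cat_def)

lemma finite_discrete_limits:
  assumes "universe (\<kappa> :: 'u rel)" "bicomplete \<kappa> C" "finite (A :: 'u set)" "is_functor (discrete_cat A) C D"
  shows "\<exists>X \<pi>. is_limit (discrete_cat A) C D X \<pi>" "\<exists>X \<iota>. is_colimit (discrete_cat A) C D X \<iota>"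
proof -
  have sm: "small \<kappa> (Obj (discrete_cat A))" "small \<kappa> (Arr (discrete_cat A))"
    using small_finite[OF assms(1,3)] by (simp_all add: discrete_cat_def)
  note lims = assms(2)[unfolded bicomplete_def, rule_format, OF category_discrete_cat sm assms(4)]
  show "\<exists>X \<pi>. is_limit (discrete_cat A) C D X \<pi>" "\<exists>X \<iota>. is_colimit (discrete_cat A) C D X \<iota>"
    by (rule lims[THEN conjunct1], rule lims[THEN conjunct2])
qed

lemma terminal_exists:
  assumes "universe (\<kappa> :: 'u rel)" "category C" "bicomplete \<kappa> C"
  shows "\<exists>t. is_terminal C t"
proof -
  let ?J = "discrete_cat ({} :: 'u set)"
  let ?D = "\<lparr>fobj = \<lambda>_. undefined, farr = \<lambda>x. Idn C undefined\<rparr>"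
  have "is_functor ?J C ?D" using functor_discrete_cat[OF assms(2), of "{}" "\<lambda>_. undefined"] by simp
  from finite_discrete_limits(1)[OF assms(1,3) finite.emptyI this]
  obtain X \<pi> where "is_limit ?J C ?D X \<pi>" by (elim exE)
  moreover have "is_cone ?J C ?D Y \<nu> \<longleftrightarrow> Y \<in> Obj C" for Y \<nu>
    using cone_discrete_cat[OF assms(2), of "{}" "\<lambda>_. undefined"] by simp
  ultimately have "is_terminal C X"
    unfolding is_limit_def is_terminal_def by (auto simp: discrete_cat_def)
  then show ?thesis by blast
qed

lemma initial_exists:
  assumes "universe (\<kappa> :: 'u rel)" "category C" "bicomplete \<kappa> C"
  shows "\<exists>t. is_initial C t"
proof -
  let ?J = "discrete_cat ({} :: 'u set)"
  let ?D = "\<lparr>fobj = \<lambda>_. undefined, farr = \<lambda>x. Idn C undefined\<rparr>"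
  have F: "is_functor ?J C ?D" using functor_discrete_cat[OF assms(2), of "{}" "\<lambda>_. undefined"] by simp
  from finite_discrete_limits(2)[OF assms(1,3) finite.emptyI this]
  obtain X \<iota> where "is_colimit ?J C ?D X \<iota>" by (elim exE)
  moreover have "is_cocone ?J C ?D Y \<nu> \<longleftrightarrow> Y \<in> Obj C" for Y \<nu>
    using F unfolding is_cocone_def by (auto simp: discrete_cat_def)
  ultimately have "is_initial C X"
    unfolding is_colimit_def is_initial_def by (auto simp: discrete_cat_def)
  then show ?thesis by blast
qed

definition is_product :: "('o, 'm) cat \<Rightarrow> 'o \<Rightarrow> 'o \<Rightarrow> 'o \<Rightarrow> 'm \<Rightarrow> 'm \<Rightarrow> bool" where
  "is_product C X Y P p q \<longleftrightarrow> p \<in> homset C P X \<and> q \<in> homset C P Y \<and>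
     (\<forall>W. \<forall>u\<in>homset C W X. \<forall>v\<in>homset C W Y.
        \<exists>!h. h \<in> homset C W P \<and> p \<cdot>\<^bsub>C\<^esub> h = u \<and> q \<cdot>\<^bsub>C\<^esub> h = v)"

lemma is_product_sym: "is_product C X Y P p q \<Longrightarrow> is_product C Y X P q p"
  unfolding is_product_def by (simp add: conj_commute)

lemma is_product_lift:
  assumes "is_product C X Y P p q" "u \<in> homset C W X" "v \<in> homset C W Y"
  obtains h where "h \<in> homset C W P" "p \<cdot>\<^bsub>C\<^esub> h = u" "q \<cdot>\<^bsub>C\<^esub> h = v"
  using assms unfolding is_product_def by blast

lemma is_product_eq:
  assumes "category C" "is_product C X Y P p q" "h \<in> homset C W P" "k \<in> homset C W P"
    "p \<cdot>\<^bsub>C\<^esub> h = p \<cdot>\<^bsub>C\<^esub> k" "q \<cdot>\<^bsub>C\<^esub> h = q \<cdot>\<^bsub>C\<^esub> k"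
  shows "h = k"
proof -
  have "p \<in> homset C P X" "q \<in> homset C P Y" using assms(2) unfolding is_product_def by blast+
  from comp_homset[OF assms(1,3) this(1)] comp_homset[OF assms(1,3) this(2)]
  have "\<exists>!h'. h' \<in> homset C W P \<and> p \<cdot>\<^bsub>C\<^esub> h' = p \<cdot>\<^bsub>C\<^esub> h \<and> q \<cdot>\<^bsub>C\<^esub> h' = q \<cdot>\<^bsub>C\<^esub> h"
    using assms(2) unfolding is_product_def by blast
  then show ?thesis using assms(3-6) by metis
qed

lemma product_exists:
  assumes "universe (\<kappa> :: 'u rel)" "category C" "bicomplete \<kappa> C" "X \<in> Obj C" "Y \<in> Obj C"
  shows "\<exists>P p q. is_product C X Y P p q"
proof -
  obtain a b :: 'u where ab: "a \<noteq> b"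
    using universe_infinite[OF assms(1)] ex_new_if_finite[of "{undefined}"] by blast
  let ?Z = "\<lambda>x. if x = a then X else Y"
  let ?J = "discrete_cat {a, b}"
  let ?D = "\<lparr>fobj = ?Z, farr = \<lambda>x. Idn C (?Z x)\<rparr>"
  have "is_functor ?J C ?D" using functor_discrete_cat[OF assms(2), of "{a, b}" ?Z] assms(4,5) by auto
  from finite_discrete_limits(1)[OF assms(1,3) _ this]
  obtain P \<pi> where L: "is_limit ?J C ?D P \<pi>" by auto
  have cone: "is_cone ?J C ?D W \<nu> \<longleftrightarrow>
      W \<in> Obj C \<and> \<nu> a \<in> homset C W X \<and> \<nu> b \<in> homset C W Y" for W \<nu>
    using cone_discrete_cat[OF assms(2), of "{a, b}" ?Z] assms(4,5) ab by auto
  have "is_product C X Y P (\<pi> a) (\<pi> b)"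
    unfolding is_product_def
  proof (intro conjI allI ballI)
    show "\<pi> a \<in> homset C P X" "\<pi> b \<in> homset C P Y" using L cone unfolding is_limit_def by auto
    fix W u v assume uv: "u \<in> homset C W X" "v \<in> homset C W Y"
    then have "is_cone ?J C ?D W (\<lambda>x. if x = a then u else v)"
      using cone ab homset_Obj[OF assms(2)] by auto
    then have "\<exists>!h. h \<in> homset C W P \<and> (\<forall>j\<in>Obj ?J. \<pi> j \<cdot>\<^bsub>C\<^esub> h = (if j = a then u else v))"
      using L unfolding is_limit_def by blast
    then show "\<exists>!h. h \<in> homset C W P \<and> \<pi> a \<cdot>\<^bsub>C\<^esub> h = u \<and> \<pi> b \<cdot>\<^bsub>C\<^esub> h = v"
      using ab by (simp add: discrete_cat_def)
  qed
  then show ?thesis by blast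
qed


section \<open>Lifting properties and the retract argument\<close>

lemma factorization:
  assumes "functorial_factorization C P L R" "f \<in> homset C X Y" "f \<in> P"
  obtains Z l r where "l \<in> homset C X Z" "r \<in> homset C Z Y" "l \<in> L" "r \<in> R" "r \<cdot>\<^bsub>C\<^esub> l = f"
proof -
  obtain Z l r where n: "nat_trans (arrow_cat C P) C (dom_func C) Z l"
      "nat_trans (arrow_cat C P) C Z (cod_func C) r"
    and f: "\<forall>f\<in>Arr C \<inter> P. l f \<in> L \<and> r f \<in> R \<and> r f \<cdot>\<^bsub>C\<^esub> l f = f"
    using assms(1) unfolding functorial_factorization_def by blast
  have "f \<in> Obj (arrow_cat C P)" using assms by (simp add: arrow_cat_def homset_def)
  from nat_trans_homset[OF n(1) this] nat_trans_homset[OF n(2) this]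
  show thesis using that[of "l f" "fobj Z f" "r f"] f assms(2,3)
    by (auto simp: dom_func_def cod_func_def homset_def)
qed

lemma liftsD:
  assumes "lifts C f p" "f \<in> homset C A B" "p \<in> homset C X Y"
    "u \<in> homset C A X" "v \<in> homset C B Y" "p \<cdot>\<^bsub>C\<^esub> u = v \<cdot>\<^bsub>C\<^esub> f"
  obtains h where "h \<in> homset C B X" "h \<cdot>\<^bsub>C\<^esub> f = u" "p \<cdot>\<^bsub>C\<^esub> h = v"
  using assms unfolding lifts_def homset_def by fast

text \<open>Factor \<open>f = r \<cdot> l\<close>; a lift of the identity of the codomain against \<open>r\<close> exhibits \<open>f\<close> as a
  retract of \<open>l\<close>.\<close>

lemma retract_argument_left:
  assumes "category C" "functorial_factorization C P L R" "retract_closed C L"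
    and f: "f \<in> Arr C" "f \<in> P" and lift: "\<And>p. p \<in> R \<Longrightarrow> lifts C f p"
  shows "f \<in> L"
proof -
  define X Y where "X = Dom C f" and "Y = Cod C f"
  have fh: "f \<in> homset C X Y" using f by (simp add: X_def Y_def homset_def)
  obtain Z l r where lr: "l \<in> homset C X Z" "r \<in> homset C Z Y" "l \<in> L" "r \<in> R" "r \<cdot>\<^bsub>C\<^esub> l = f"
    using factorization[OF assms(2) fh f(2)] .
  have idY: "Idn C Y \<in> homset C Y Y" and idX: "Idn C X \<in> homset C X X"
    using homset_Obj[OF assms(1) fh] Idn_homset[OF assms(1)] by auto
  have "r \<cdot>\<^bsub>C\<^esub> l = Idn C Y \<cdot>\<^bsub>C\<^esub> f" using lr(5) comp_Idn[OF assms(1) fh] by simp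
  from liftsD[OF lift[OF lr(4)] fh lr(2,1) idY this]
  obtain h where h: "h \<in> homset C Y Z" "h \<cdot>\<^bsub>C\<^esub> f = l" "r \<cdot>\<^bsub>C\<^esub> h = Idn C Y" .
  have "arrow_retract C f l"
    unfolding arrow_retract_def
  proof (intro conjI bexI)
    show "l \<cdot>\<^bsub>C\<^esub> Idn C X = h \<cdot>\<^bsub>C\<^esub> f" using h(2) comp_Idn[OF assms(1) lr(1)] by simp
    show "f \<cdot>\<^bsub>C\<^esub> Idn C X = r \<cdot>\<^bsub>C\<^esub> l" using lr(5) comp_Idn[OF assms(1) fh] by simp
    show "Idn C X \<cdot>\<^bsub>C\<^esub> Idn C X = Idn C (Dom C f)"
      using comp_Idn[OF assms(1) idX] by (simp add: X_def)
    show "r \<cdot>\<^bsub>C\<^esub> h = Idn C (Cod C f)" using h(3) by (simp add: Y_def)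
  qed (use lr h idX fh in \<open>auto simp: homset_def\<close>)
  then show ?thesis using assms(3) lr(3) unfolding retract_closed_def by blast
qed

lemma retract_argument_right:
  assumes "category C" "functorial_factorization C UNIV L R" "retract_closed C R"
    and f: "f \<in> Arr C" and lift: "\<And>i. i \<in> L \<Longrightarrow> lifts C i f"
  shows "f \<in> R"
proof -
  define X Y where "X = Dom C f" and "Y = Cod C f"
  have fh: "f \<in> homset C X Y" using f by (simp add: X_def Y_def homset_def)
  obtain Z l r where lr: "l \<in> homset C X Z" "r \<in> homset C Z Y" "l \<in> L" "r \<in> R" "r \<cdot>\<^bsub>C\<^esub> l = f"
    using factorization[OF assms(2) fh UNIV_I] .
  have idY: "Idn C Y \<in> homset C Y Y" and idX: "Idn C X \<in> homset C X X"
    using homset_Obj[OF assms(1) fh] Idn_homset[OF assms(1)] by auto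
  have "f \<cdot>\<^bsub>C\<^esub> Idn C X = r \<cdot>\<^bsub>C\<^esub> l" using lr(5) comp_Idn[OF assms(1) fh] by simp
  from liftsD[OF lift[OF lr(3)] lr(1) fh idX lr(2) this]
  obtain h where h: "h \<in> homset C Z X" "h \<cdot>\<^bsub>C\<^esub> l = Idn C X" "f \<cdot>\<^bsub>C\<^esub> h = r" .
  have "arrow_retract C f r"
    unfolding arrow_retract_def
  proof (intro conjI bexI)
    show "r \<cdot>\<^bsub>C\<^esub> l = Idn C Y \<cdot>\<^bsub>C\<^esub> f" using lr(5) comp_Idn[OF assms(1) fh] by simp
    show "f \<cdot>\<^bsub>C\<^esub> h = Idn C Y \<cdot>\<^bsub>C\<^esub> r" using h(3) comp_Idn[OF assms(1) lr(2)] by simp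
    show "Idn C Y \<cdot>\<^bsub>C\<^esub> Idn C Y = Idn C (Cod C f)"
      using comp_Idn[OF assms(1) idY] by (simp add: Y_def)
    show "h \<cdot>\<^bsub>C\<^esub> l = Idn C (Dom C f)" using h(2) by (simp add: X_def)
  qed (use lr h idY fh in \<open>auto simp: homset_def\<close>)
  then show ?thesis using assms(3) lr(4) unfolding retract_closed_def by blast
qed

lemma retract_closed_Int: "retract_closed C P \<Longrightarrow> retract_closed C P' \<Longrightarrow> retract_closed C (P \<inter> P')"
  unfolding retract_closed_def by blast

lemma two_of_three_comp:
  "two_of_three C W \<Longrightarrow> f \<in> homset C X Y \<Longrightarrow> g \<in> homset C Y Z \<Longrightarrow> f \<in> W \<Longrightarrow> g \<in> W \<Longrightarrow> g \<cdot>\<^bsub>C\<^esub> f \<in> W"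
  unfolding two_of_three_def homset_def by auto

lemma two_of_three_left:
  "two_of_three C W \<Longrightarrow> f \<in> homset C X Y \<Longrightarrow> g \<in> homset C Y Z \<Longrightarrow> f \<in> W \<Longrightarrow> g \<cdot>\<^bsub>C\<^esub> f \<in> W \<Longrightarrow> g \<in> W"
  unfolding two_of_three_def homset_def by auto

lemma two_of_three_right:
  "two_of_three C W \<Longrightarrow> f \<in> homset C X Y \<Longrightarrow> g \<in> homset C Y Z \<Longrightarrow> g \<in> W \<Longrightarrow> g \<cdot>\<^bsub>C\<^esub> f \<in> W \<Longrightarrow> f \<in> W"
  unfolding two_of_three_def homset_def by auto


section \<open>Model categories\<close>

locale model_cat =
  fixes \<kappa> :: "'u rel" and C :: "('o, 'm) cat" and S :: "'m mstruct"
  assumes model: "model_category \<kappa> C S"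
begin

lemma cat: "category C" and bicomp: "bicomplete \<kappa> C"
  and weq23: "two_of_three C (weq S)" and weq_retract: "retract_closed C (weq S)"
  and fib_retract: "retract_closed C (fib S)"
  and tfib_lift: "i \<in> cof S \<Longrightarrow> p \<in> fib S \<inter> weq S \<Longrightarrow> lifts C i p"
  and fib_lift: "i \<in> cof S \<inter> weq S \<Longrightarrow> p \<in> fib S \<Longrightarrow> lifts C i p"
  and factor_tfib: "functorial_factorization C UNIV (cof S) (fib S \<inter> weq S)"
  and factor_tcof: "functorial_factorization C UNIV (cof S \<inter> weq S) (fib S)"
  and weq_Arr: "weq S \<subseteq> Arr C" and fib_Arr: "fib S \<subseteq> Arr C" and cof_Arr: "cof S \<subseteq> Arr C"
  using model unfolding model_category_def by auto

text \<open>The trivial fibrations depend on the cofibrations alone, and the fibrations on the trivial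
  cofibrations alone.\<close>

lemma tfib_iff: "p \<in> fib S \<inter> weq S \<longleftrightarrow> p \<in> Arr C \<and> (\<forall>i\<in>cof S. lifts C i p)"
  using retract_argument_right[OF cat factor_tfib retract_closed_Int[OF fib_retract weq_retract]]
    tfib_lift weq_Arr by blast

lemma fib_iff: "p \<in> fib S \<longleftrightarrow> p \<in> Arr C \<and> (\<forall>i\<in>cof S \<inter> weq S. lifts C i p)"
  using retract_argument_right[OF cat factor_tcof fib_retract] fib_lift fib_Arr by blast

text \<open>The axioms do not list identities among the weak equivalences. Any weak equivalence \<open>r\<close> into
  \<open>X\<close> satisfies \<open>Idn C X \<cdot> r = r\<close>, and two-out-of-three applies.\<close>

lemma Idn_weq:
  assumes "X \<in> Obj C"
  shows "Idn C X \<in> weq S"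
proof -
  note i = Idn_homset[OF cat assms]
  obtain Z l r where "r \<in> homset C Z X" "r \<in> fib S \<inter> weq S"
    using factorization[OF factor_tfib i UNIV_I] by metis
  then show ?thesis
    using two_of_three_left[OF weq23 _ i] comp_Idn[OF cat] by fastforce
qed

lemma fib_comp:
  assumes "p \<in> homset C X Y" "q \<in> homset C Y Z" "p \<in> fib S" "q \<in> fib S"
  shows "q \<cdot>\<^bsub>C\<^esub> p \<in> fib S"
  unfolding fib_iff
proof (intro conjI ballI)
  show "q \<cdot>\<^bsub>C\<^esub> p \<in> Arr C" using comp_homset[OF cat assms(1,2)] by (rule homsetD)
  fix i assume i: "i \<in> cof S \<inter> weq S"
  define A B where "A = Dom C i" and "B = Cod C i"
  have ih: "i \<in> homset C A B" using i cof_Arr by (auto simp: A_def B_def homset_def)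
  note qph = comp_homset[OF cat assms(1,2)]
  show "lifts C i (q \<cdot>\<^bsub>C\<^esub> p)"
    unfolding lifts_def A_def[symmetric] B_def[symmetric] homsetD(2,3)[OF qph]
  proof (intro ballI impI)
    fix u v assume uv: "u \<in> homset C A X" "v \<in> homset C B Z" and e: "q \<cdot>\<^bsub>C\<^esub> p \<cdot>\<^bsub>C\<^esub> u = v \<cdot>\<^bsub>C\<^esub> i"
    then have "q \<cdot>\<^bsub>C\<^esub> (p \<cdot>\<^bsub>C\<^esub> u) = v \<cdot>\<^bsub>C\<^esub> i" using comp_assoc[OF cat uv(1) assms(1,2)] by simp
    from liftsD[OF fib_lift[OF i assms(4)] ih assms(2) comp_homset[OF cat uv(1) assms(1)] uv(2) this]
    obtain h where h: "h \<in> homset C B Y" "h \<cdot>\<^bsub>C\<^esub> i = p \<cdot>\<^bsub>C\<^esub> u" "q \<cdot>\<^bsub>C\<^esub> h = v" .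
    from liftsD[OF fib_lift[OF i assms(3)] ih assms(1) uv(1) h(1) h(2)[symmetric]]
    obtain k where k: "k \<in> homset C B X" "k \<cdot>\<^bsub>C\<^esub> i = u" "p \<cdot>\<^bsub>C\<^esub> k = h" .
    have "q \<cdot>\<^bsub>C\<^esub> p \<cdot>\<^bsub>C\<^esub> k = v" using comp_assoc[OF cat k(1) assms(1,2)] k(3) h(3) by simp
    with k show "\<exists>h\<in>homset C B X. h \<cdot>\<^bsub>C\<^esub> i = u \<and> q \<cdot>\<^bsub>C\<^esub> p \<cdot>\<^bsub>C\<^esub> h = v" by blast
  qed
qed

lemma fibrant_fib:
  assumes "p \<in> homset C X Y" "p \<in> fib S" "fibrant C S Y"
  shows "fibrant C S X"
  using assms fib_comp comp_homset[OF cat] homset_Obj[OF cat] unfolding fibrant_def by blast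

text \<open>A lifting problem against the first projection is solved componentwise; the second component
  is an extension problem into the fibrant object \<open>Y\<close>.\<close>

lemma proj_fib:
  assumes "is_product C X Y P p q" "fibrant C S Y"
  shows "p \<in> fib S"
  unfolding fib_iff
proof (intro conjI ballI)
  have pq: "p \<in> homset C P X" "q \<in> homset C P Y" using assms(1) unfolding is_product_def by blast+
  then show "p \<in> Arr C" by (simp add: homset_def)
  obtain t f where t: "is_terminal C t" "f \<in> homset C Y t" "f \<in> fib S"
    using assms(2) unfolding fibrant_def by blast
  fix i assume i: "i \<in> cof S \<inter> weq S"
  define A B where "A = Dom C i" and "B = Cod C i"
  have ih: "i \<in> homset C A B" using i cof_Arr by (auto simp: A_def B_def homset_def)
  show "lifts C i p"
    unfolding lifts_def A_def[symmetric] B_def[symmetric] homsetD(2,3)[OF pq(1)]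
  proof (intro ballI impI)
    fix u v assume uv: "u \<in> homset C A P" "v \<in> homset C B X" and e: "p \<cdot>\<^bsub>C\<^esub> u = v \<cdot>\<^bsub>C\<^esub> i"
    have qu: "q \<cdot>\<^bsub>C\<^esub> u \<in> homset C A Y" using comp_homset[OF cat uv(1) pq(2)] .
    obtain b where b: "b \<in> homset C B t" using t(1) homset_Obj[OF cat ih] unfolding is_terminal_def by blast
    have "f \<cdot>\<^bsub>C\<^esub> (q \<cdot>\<^bsub>C\<^esub> u) = b \<cdot>\<^bsub>C\<^esub> i"
      using t(1) homset_Obj[OF cat ih] comp_homset[OF cat qu t(2)] comp_homset[OF cat ih b]
      unfolding is_terminal_def by blast
    from liftsD[OF fib_lift[OF i t(3)] ih t(2) qu b this]
    obtain k where k: "k \<in> homset C B Y" "k \<cdot>\<^bsub>C\<^esub> i = q \<cdot>\<^bsub>C\<^esub> u" .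
    obtain h where h: "h \<in> homset C B P" "p \<cdot>\<^bsub>C\<^esub> h = v" "q \<cdot>\<^bsub>C\<^esub> h = k"
      using is_product_lift[OF assms(1) uv(2) k(1)] .
    have "h \<cdot>\<^bsub>C\<^esub> i = u"
      by (rule is_product_eq[OF cat assms(1) comp_homset[OF cat ih h(1)] uv(1)])
        (use comp_assoc[OF cat ih h(1) pq(1)] comp_assoc[OF cat ih h(1) pq(2)] h e k in auto)
    with h show "\<exists>h\<in>homset C B P. h \<cdot>\<^bsub>C\<^esub> i = u \<and> p \<cdot>\<^bsub>C\<^esub> h = v" by blast
  qed
qed

end

text \<open>The part of a left Bousfield localization that lifting arguments use: a second model
  structure with the same cofibrations.\<close>

locale localized = base: model_cat \<kappa> C S + loc: model_cat \<kappa> C S'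
  for \<kappa> :: "'u rel" and C :: "('o, 'm) cat" and S S' :: "'m mstruct" +
  assumes univ: "universe \<kappa>" and cof_eq: "cof S' = cof S"
begin

lemma tfib_eq: "fib S' \<inter> weq S' = fib S \<inter> weq S"
  using base.tfib_iff loc.tfib_iff cof_eq by blast

text \<open>As \<open>X\<close> is fibrant, \<open>i\<close> has a retraction \<open>r\<close>. As \<open>Z\<close> is fibrant, a path object
  \<open>Z \<rightarrow> V \<rightarrow> Z \<times> Z\<close> formed in \<open>S'\<close> has end point projections that are trivial fibrations of
  \<open>S'\<close>, hence of \<open>S\<close>. The maps \<open>i \<cdot> r\<close> and the identity of \<open>Z\<close> agree after \<open>i\<close>, so lifting
  against \<open>V \<rightarrow> Z \<times> Z\<close> gives a homotopy between them. Read in \<open>S\<close>, this homotopy makes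
  \<open>i \<cdot> r\<close> a weak equivalence, and \<open>i\<close> is a retract of \<open>i \<cdot> r\<close>.\<close>

lemma tcof_between_fibrant:
  assumes i: "i \<in> homset C X Z" "i \<in> cof S'" "i \<in> weq S'"
    and X: "fibrant C S' X" and Z: "fibrant C S' Z"
  shows "i \<in> weq S"
proof -
  note cat = base.cat
  have XZ: "X \<in> Obj C" "Z \<in> Obj C" using homset_Obj[OF cat i(1)] by auto
  note idX = Idn_homset[OF cat XZ(1)] and idZ = Idn_homset[OF cat XZ(2)]
  obtain t f where t: "is_terminal C t" "f \<in> homset C X t" "f \<in> fib S'"
    using X unfolding fibrant_def by blast
  obtain b where b: "b \<in> homset C Z t" using t(1) XZ unfolding is_terminal_def by blast
  have "f \<cdot>\<^bsub>C\<^esub> Idn C X = b \<cdot>\<^bsub>C\<^esub> i"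
    using t(1) XZ comp_homset[OF cat idX t(2)] comp_homset[OF cat i(1) b]
    unfolding is_terminal_def by blast
  from liftsD[OF loc.fib_lift[OF _ t(3)] i(1) t(2) idX b this] i
  obtain r where r: "r \<in> homset C Z X" "r \<cdot>\<^bsub>C\<^esub> i = Idn C X" by blast
  (* The path object of Z in S'. *)
  obtain P p q where P: "is_product C Z Z P p q"
    using product_exists[OF univ cat base.bicomp XZ(2) XZ(2)] by blast
  have pq: "p \<in> homset C P Z" "q \<in> homset C P Z" using P unfolding is_product_def by blast+
  obtain \<Delta> where \<Delta>: "\<Delta> \<in> homset C Z P" "p \<cdot>\<^bsub>C\<^esub> \<Delta> = Idn C Z" "q \<cdot>\<^bsub>C\<^esub> \<Delta> = Idn C Z"
    using is_product_lift[OF P idZ idZ] .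
  obtain V s d where sd: "s \<in> homset C Z V" "d \<in> homset C V P"
      "s \<in> cof S' \<inter> weq S'" "d \<in> fib S'" "d \<cdot>\<^bsub>C\<^esub> s = \<Delta>"
    using factorization[OF loc.factor_tcof \<Delta>(1) UNIV_I] .
  have end_weq: "e \<cdot>\<^bsub>C\<^esub> d \<in> weq S"
    if e: "e \<in> homset C P Z" "e \<in> fib S'" "e \<cdot>\<^bsub>C\<^esub> \<Delta> = Idn C Z" for e
  proof -
    have "(e \<cdot>\<^bsub>C\<^esub> d) \<cdot>\<^bsub>C\<^esub> s = Idn C Z" using comp_assoc[OF cat sd(1,2) e(1)] sd(5) e(3) by simp
    then have "e \<cdot>\<^bsub>C\<^esub> d \<in> weq S'"
      using two_of_three_left[OF loc.weq23 sd(1) comp_homset[OF cat sd(2) e(1)]] sd(3)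
        loc.Idn_weq[OF XZ(2)] by simp
    then show ?thesis using loc.fib_comp[OF sd(2) e(1) sd(4) e(2)] tfib_eq by blast
  qed
  have pd: "p \<cdot>\<^bsub>C\<^esub> d \<in> weq S" using end_weq[OF pq(1) loc.proj_fib[OF P Z] \<Delta>(2)] .
  have qd: "q \<cdot>\<^bsub>C\<^esub> d \<in> weq S" using end_weq[OF pq(2) loc.proj_fib[OF is_product_sym[OF P] Z] \<Delta>(3)] .
  (* A lift h : Z -> V of w = (i r, id) along i is the homotopy. *)
  note ir = comp_homset[OF cat r(1) i(1)]
  obtain w where w: "w \<in> homset C Z P" "p \<cdot>\<^bsub>C\<^esub> w = i \<cdot>\<^bsub>C\<^esub> r" "q \<cdot>\<^bsub>C\<^esub> w = Idn C Z"
    using is_product_lift[OF P ir idZ] .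
  note si = comp_homset[OF cat i(1) sd(1)]
  have \<Delta>i: "d \<cdot>\<^bsub>C\<^esub> (s \<cdot>\<^bsub>C\<^esub> i) = \<Delta> \<cdot>\<^bsub>C\<^esub> i" using comp_assoc[OF cat i(1) sd(1,2)] sd(5) by simp
  have "\<Delta> \<cdot>\<^bsub>C\<^esub> i = w \<cdot>\<^bsub>C\<^esub> i"
  proof (rule is_product_eq[OF cat P comp_homset[OF cat i(1) \<Delta>(1)] comp_homset[OF cat i(1) w(1)]])
    have "p \<cdot>\<^bsub>C\<^esub> (w \<cdot>\<^bsub>C\<^esub> i) = i"
      using comp_assoc[OF cat i(1) w(1) pq(1)] w(2) comp_assoc[OF cat i(1) r(1) i(1)] r(2)
        comp_Idn[OF cat i(1)] by simp
    then show "p \<cdot>\<^bsub>C\<^esub> (\<Delta> \<cdot>\<^bsub>C\<^esub> i) = p \<cdot>\<^bsub>C\<^esub> (w \<cdot>\<^bsub>C\<^esub> i)"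
      using comp_assoc[OF cat i(1) \<Delta>(1) pq(1)] \<Delta>(2) comp_Idn[OF cat i(1)] by simp
    show "q \<cdot>\<^bsub>C\<^esub> (\<Delta> \<cdot>\<^bsub>C\<^esub> i) = q \<cdot>\<^bsub>C\<^esub> (w \<cdot>\<^bsub>C\<^esub> i)"
      using comp_assoc[OF cat i(1) \<Delta>(1) pq(2)] comp_assoc[OF cat i(1) w(1) pq(2)] \<Delta>(3) w(3) by simp
  qed
  with \<Delta>i have "d \<cdot>\<^bsub>C\<^esub> (s \<cdot>\<^bsub>C\<^esub> i) = w \<cdot>\<^bsub>C\<^esub> i" by simp
  from liftsD[OF loc.fib_lift[OF _ sd(4)] i(1) sd(2) si w(1) this] i
  obtain h where h: "h \<in> homset C Z V" "d \<cdot>\<^bsub>C\<^esub> h = w" by blast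
  have "(q \<cdot>\<^bsub>C\<^esub> d) \<cdot>\<^bsub>C\<^esub> h = Idn C Z" using comp_assoc[OF cat h(1) sd(2) pq(2)] h(2) w(3) by simp
  then have "h \<in> weq S"
    using two_of_three_right[OF base.weq23 h(1) comp_homset[OF cat sd(2) pq(2)] qd]
      base.Idn_weq[OF XZ(2)] by simp
  then have "(p \<cdot>\<^bsub>C\<^esub> d) \<cdot>\<^bsub>C\<^esub> h \<in> weq S"
    using two_of_three_comp[OF base.weq23 h(1) comp_homset[OF cat sd(2) pq(1)]] pd by simp
  then have irW: "i \<cdot>\<^bsub>C\<^esub> r \<in> weq S" using comp_assoc[OF cat h(1) sd(2) pq(1)] h(2) w(2) by simp
  have iri: "(i \<cdot>\<^bsub>C\<^esub> r) \<cdot>\<^bsub>C\<^esub> i = i" using comp_assoc[OF cat i(1) r(1) i(1)] r(2) comp_Idn[OF cat i(1)] by simp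
  have "arrow_retract C i (i \<cdot>\<^bsub>C\<^esub> r)"
    unfolding arrow_retract_def homsetD(2,3)[OF i(1)] homsetD(2,3)[OF ir]
    using i(1) ir r idZ iri comp_Idn[OF cat i(1)] comp_Idn[OF cat ir] comp_Idn[OF cat idZ]
    by (metis homsetD(1))
  then show ?thesis using base.weq_retract irW unfolding retract_closed_def by blast
qed

text \<open>The comparison of the two notions of weak equivalence on local objects: factor \<open>f\<close> in
  \<open>S'\<close> as a trivial cofibration, treated above, and a trivial fibration, common to both
  structures.\<close>

lemma weq_between_fibrant:
  assumes f: "f \<in> homset C X Y" "f \<in> weq S'" and "fibrant C S' X" "fibrant C S' Y"
  shows "f \<in> weq S"
proof -
  obtain Z l p where lp: "l \<in> homset C X Z" "p \<in> homset C Z Y"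
      "l \<in> cof S' \<inter> weq S'" "p \<in> fib S'" "p \<cdot>\<^bsub>C\<^esub> l = f"
    using factorization[OF loc.factor_tcof f(1) UNIV_I] .
  have "p \<in> weq S'" using two_of_three_left[OF loc.weq23 lp(1,2)] lp(3,5) f(2) by simp
  then have "p \<in> weq S" using lp(4) tfib_eq by blast
  moreover have "l \<in> weq S"
    using tcof_between_fibrant[OF lp(1)] lp(3) assms(3) loc.fibrant_fib[OF lp(2,4) assms(4)] by simp
  ultimately show ?thesis using two_of_three_comp[OF base.weq23 lp(1,2)] lp(5) by simp
qed

end

text \<open>If \<open>b : B \<rightarrow> X\<close> is a cosimplicial resolution and \<open>f : X \<rightarrow> Y\<close> is a weak equivalence, then
  \<open>f \<cdot> b\<close> makes the same \<open>B\<close> a resolution of \<open>Y\<close>. So resolutions that compute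
  \<open>map(Idn X, N)\<close> also compute \<open>map(f, N)\<close>, with the same map of simplicial sets.\<close>

lemma map_weak_equivalence_of_weq:
  assumes "model_category \<kappa> C S" "f \<in> weq S" "map_weak_equivalence C S (Idn C (Dom C f)) N"
  shows "map_weak_equivalence C S f N"
proof -
  interpret model_cat \<kappa> C S using assms(1) by unfold_locales
  define X Y where "X = Dom C f" and "Y = Cod C f"
  have f: "f \<in> homset C X Y" using assms(2) weq_Arr by (auto simp: X_def Y_def homset_def)
  have X: "X \<in> Obj C" and Y: "Y \<in> Obj C" using homset_Obj[OF cat f] by auto
  note idX = Idn_homset[OF cat X]
  obtain A a B b \<phi> j where
      A: "cosimplicial_resolution C S X A a" and B: "cosimplicial_resolution C S X B b"
    and \<phi>: "nat_trans simplex_cat C A B \<phi>" "\<forall>n. b n \<cdot>\<^bsub>C\<^esub> \<phi> n = Idn C X \<cdot>\<^bsub>C\<^esub> a n"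
    and j: "j \<in> weq S" "Dom C j = N" "fibrant C S (Cod C j)"
    and w: "sset_weak_equivalence (mapping_sset C B (Cod C j)) (mapping_sset C A (Cod C j))
          (\<lambda>n g. g \<cdot>\<^bsub>C\<^esub> \<phi> n)"
    using assms(3) unfolding map_weak_equivalence_def X_def[symmetric] homsetD(2,3)[OF idX]
    by blast
  have AB: "is_functor simplex_cat C A" "is_functor simplex_cat C B" using \<phi>(1) unfolding nat_trans_def by auto
  have a: "a n \<in> homset C (fobj A n) X" and b: "b n \<in> homset C (fobj B n) X"
    and ph: "\<phi> n \<in> homset C (fobj A n) (fobj B n)" for n
    using A B \<phi>(1) unfolding cosimplicial_resolution_def nat_trans_def
    by (auto simp: const_func_def simplex_cat_def)
  have "cosimplicial_resolution C S Y B (\<lambda>n. f \<cdot>\<^bsub>C\<^esub> b n)"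
    unfolding cosimplicial_resolution_def
  proof (intro conjI allI)
    show "Y \<in> Obj C" by fact
    show "reedy_cofibrant C S B" using B unfolding cosimplicial_resolution_def by blast
    show "f \<cdot>\<^bsub>C\<^esub> b n \<in> weq S" for n
      using two_of_three_comp[OF weq23 b f] assms(2) B unfolding cosimplicial_resolution_def by blast
    show "nat_trans simplex_cat C B (const_func C Y) (\<lambda>n. f \<cdot>\<^bsub>C\<^esub> b n)"
    proof (rule nat_transI)
      show "is_functor simplex_cat C B" by fact
      show "is_functor simplex_cat C (const_func C Y)"
        using AB(1) Idn_homset[OF cat Y] comp_Idn[OF cat Idn_homset[OF cat Y]] Y
        by (auto simp: is_functor_def const_func_def)
      show "f \<cdot>\<^bsub>C\<^esub> b n \<in> homset C (fobj B n) (fobj (const_func C Y) n)" for n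
        using comp_homset[OF cat b f] by (simp add: const_func_def)
      fix \<alpha> m n assume \<alpha>: "\<alpha> \<in> homset simplex_cat m n"
      have "b n \<cdot>\<^bsub>C\<^esub> farr B \<alpha> = Idn C X \<cdot>\<^bsub>C\<^esub> b m"
        using nat_trans_square[OF _ \<alpha>] B unfolding cosimplicial_resolution_def
        by (metis const_func_def func.select_convs(2))
      then have "b n \<cdot>\<^bsub>C\<^esub> farr B \<alpha> = b m" using comp_Idn[OF cat b] by simp
      then show "f \<cdot>\<^bsub>C\<^esub> b n \<cdot>\<^bsub>C\<^esub> farr B \<alpha> = farr (const_func C Y) \<alpha> \<cdot>\<^bsub>C\<^esub> (f \<cdot>\<^bsub>C\<^esub> b m)"
        using comp_assoc[OF cat functor_homset[OF AB(2) \<alpha>] b f] comp_Idn[OF cat comp_homset[OF cat b f]]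
        by (simp add: const_func_def)
    qed
  qed
  moreover have "(f \<cdot>\<^bsub>C\<^esub> b n) \<cdot>\<^bsub>C\<^esub> \<phi> n = f \<cdot>\<^bsub>C\<^esub> a n" for n
    using comp_assoc[OF cat ph b f] \<phi>(2) comp_Idn[OF cat a] by simp
  ultimately show ?thesis
    unfolding map_weak_equivalence_def X_def[symmetric] Y_def[symmetric]
    using homsetD(1)[OF f] A \<phi>(1) j w by blast
qed

text \<open>The local equivalences contain the identities because they are the weak equivalences of a
  model structure; the resolutions needed for the previous lemma come from there.\<close>

lemma weq_local_equivalence:
  assumes "model_category \<kappa> C S" "left_bousfield_localization \<kappa> C S \<C> S'"
  shows "weq S \<subseteq> weq S'"
proof
  fix f assume f: "f \<in> weq S"
  interpret base: model_cat \<kappa> C S using assms(1) by unfold_locales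
  interpret loc: model_cat \<kappa> C S'
    using assms(2) unfolding left_bousfield_localization_def by unfold_locales auto
  have W: "weq S' = {f. local_equivalence C S \<C> f}"
    using assms(2) unfolding left_bousfield_localization_def by blast
  have fA: "f \<in> Arr C" using f base.weq_Arr by blast
  then have "Dom C f \<in> Obj C" using base.cat unfolding category_def by blast
  from loc.Idn_weq[OF this] have "local_equivalence C S \<C> (Idn C (Dom C f))" using W by simp
  then have "local_equivalence C S \<C> f"
    using map_weak_equivalence_of_weq[OF assms(1) f] fA unfolding local_equivalence_def by blast
  then show "f \<in> weq S'" using W by simp
qed


section \<open>Calculus of zigzags in the homotopy category\<close>

text \<open>The congruence on zigzags whose classes are the morphisms of the homotopy category.\<close>

definition zz_eq ::
    "('o, 'm) cat \<Rightarrow> 'm mstruct \<Rightarrow> 'o \<Rightarrow> 'o \<Rightarrow> 'm step list \<Rightarrow> 'm step list \<Rightarrow> bool" where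
  "zz_eq C S X Y p p' \<longleftrightarrow> (p, p') \<in> (zz_rel C S X Y \<union> (zz_rel C S X Y)\<inverse>)\<^sup>*"

lemma zz_eq_refl: "zz_eq C S X Y p p"
  by (simp add: zz_eq_def)

lemma zz_eq_sym: "zz_eq C S X Y p p' \<Longrightarrow> zz_eq C S X Y p' p"
  unfolding zz_eq_def by (meson sym_Un_converse sym_rtrancl symD)

lemma zz_eq_trans [trans]: "zz_eq C S X Y p p' \<Longrightarrow> zz_eq C S X Y p' p'' \<Longrightarrow> zz_eq C S X Y p p''"
  unfolding zz_eq_def by (rule rtrancl_trans)

lemma zz_class_conv: "zz_class C S X p Y = (X, Y, Collect (zz_eq C S X Y p))"
  unfolding zz_class_def zz_eq_def by simp

lemma zz_class_eqI:
  assumes "zz_eq C S X Y p p'"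
  shows "zz_class C S X p Y = zz_class C S X p' Y"
proof -
  have "zz_eq C S X Y p t \<longleftrightarrow> zz_eq C S X Y p' t" for t
    using zz_eq_trans[OF assms, of t] zz_eq_trans[OF zz_eq_sym[OF assms], of t] by (rule iffI[rotated])
  then have "zz_eq C S X Y p = zz_eq C S X Y p'" by (intro ext)
  then show ?thesis unfolding zz_class_conv by (simp only:)
qed

lemma zigzag_Obj:
  assumes "category C" "zigzag C S X p Y"
  shows "X \<in> Obj C \<and> Y \<in> Obj C"
  using assms(2)
proof (induction p arbitrary: X)
  case (Cons s p)
  have "Dom C f \<in> Obj C" "Cod C f \<in> Obj C" if "f \<in> Arr C" for f
    using assms(1) that unfolding category_def by blast+
  with Cons show ?case by (cases s) auto
qed simp

lemma zigzag_append:
  assumes "category C"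
  shows "zigzag C S X (p @ q) Z \<longleftrightarrow> (\<exists>Y. zigzag C S X p Y \<and> zigzag C S Y q Z)"
proof (induction p arbitrary: X)
  case Nil
  then show ?case using zigzag_Obj[OF assms] by auto
next
  case (Cons s p)
  then show ?case by (cases s) auto
qed

text \<open>To show that an operation \<open>F\<close> on zigzags respects the congruence it suffices to look at
  single rewriting steps; reflexivity, symmetry and transitivity carry over.\<close>

lemma zz_eq_image_induct [consumes 1, case_names step]:
  assumes "zz_eq C S X Y p p'"
    and "\<And>p p'. (p, p') \<in> zz_rel C S X Y \<Longrightarrow> zz_eq C' S' X' Y' (F p) (F p')"
  shows "zz_eq C' S' X' Y' (F p) (F p')"
  using assms(1) unfolding zz_eq_def[of C]
proof (induction rule: rtrancl_induct)
  case base
  show ?case by (rule zz_eq_refl)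
next
  case (step y z)
  then have "zz_eq C' S' X' Y' (F y) (F z)"
    using assms(2)[of y z] zz_eq_sym[OF assms(2)[of z y]] by auto
  with step(3) show ?case by (rule zz_eq_trans)
qed

lemma zz_eq_zigzag:
  assumes "zz_eq C S X Y p p'"
  shows "zigzag C S X p Y \<longleftrightarrow> zigzag C S X p' Y"
  using assms unfolding zz_eq_def
  by (induction rule: rtrancl_induct) (auto simp: zz_rel_def)

lemma zz_relI:
  "zz_step C S a b \<Longrightarrow> zigzag C S X (p @ a @ q) Y \<Longrightarrow> zigzag C S X (p @ b @ q) Y \<Longrightarrow>
    (p @ a @ q, p @ b @ q) \<in> zz_rel C S X Y"
  unfolding zz_rel_def by blast

lemma zz_eq_context:
  assumes "category C" "zz_eq C S X Y p p'" "zigzag C S W a X" "zigzag C S Y b Z"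
  shows "zz_eq C S W Z (a @ p @ b) (a @ p' @ b)"
  using assms(2)
proof (induction rule: zz_eq_image_induct[where F = "\<lambda>p. a @ p @ b"])
  case (step p p')
  then obtain c d s t where *: "p = c @ s @ d" "p' = c @ t @ d" "zz_step C S s t"
      "zigzag C S X p Y" "zigzag C S X p' Y"
    unfolding zz_rel_def by blast
  have "zigzag C S W (a @ p @ b) Z" "zigzag C S W (a @ p' @ b) Z"
    using *(4,5) assms(3,4) zigzag_append[OF assms(1)] by blast+
  then have "((a @ c) @ s @ (d @ b), (a @ c) @ t @ (d @ b)) \<in> zz_rel C S W Z"
    using *(1-3) by (intro zz_relI) auto
  then show ?case using *(1,2) unfolding zz_eq_def by auto
qed

lemma zz_eq_append:
  assumes "category C" "zz_eq C S X Y p p'" "zz_eq C S Y Z q q'" "zigzag C S X p Y" "zigzag C S Y q Z"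
  shows "zz_eq C S X Z (p @ q) (p' @ q')"
proof -
  have "Y \<in> Obj C" "Z \<in> Obj C" "X \<in> Obj C" using zigzag_Obj[OF assms(1)] assms(4,5) by auto
  then have "zz_eq C S X Z (p @ q) (p' @ q)"
    using zz_eq_context[OF assms(1,2), of X "[]" q Z] assms(5) by simp
  also have "zz_eq C S X Z (p' @ q) (p' @ q')"
    using zz_eq_context[OF assms(1,3), of X p' "[]" Z] assms(4) zz_eq_zigzag[OF assms(2)] \<open>Z \<in> Obj C\<close>
    by simp
  finally show ?thesis .
qed

lemma zz_eq_step:
  assumes "zz_step C S a b" "zigzag C S X a Y" "zigzag C S X b Y"
  shows "zz_eq C S X Y a b"
proof -
  have "([] @ a @ [], [] @ b @ []) \<in> zz_rel C S X Y"
    using assms by (intro zz_relI) auto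
  then show ?thesis unfolding zz_eq_def by auto
qed

lemma Ho_homset: "f \<in> homset (Ho C S) X Y \<longleftrightarrow> (\<exists>p. zigzag C S X p Y \<and> f = zz_class C S X p Y)"
  by (auto simp: homset_def Ho_def zz_class_conv)

lemma Ho_Obj [simp]: "Obj (Ho C S) = Obj C"
  by (simp add: Ho_def)

lemma Ho_Idn: "Idn (Ho C S) X = zz_class C S X [] X"
  by (simp add: Ho_def)

lemma Ho_comp:
  assumes "category C" "zigzag C S X p Y" "zigzag C S Y q Z"
  shows "zz_class C S Y q Z \<cdot>\<^bsub>Ho C S\<^esub> zz_class C S X p Y = zz_class C S X (p @ q) Z"
proof -
  have *: "snd (snd (zz_class C S X (p' @ q') Z)) = snd (snd (zz_class C S X (p @ q) Z))"
    if "zz_eq C S X Y p p'" "zz_eq C S Y Z q q'" for p' q'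
    using zz_class_eqI[OF zz_eq_append[OF assms(1) that assms(2,3)]] by simp
  have "(\<Union>p'\<in>Collect (zz_eq C S X Y p). \<Union>q'\<in>Collect (zz_eq C S Y Z q).
      snd (snd (zz_class C S X (p' @ q') Z))) = snd (snd (zz_class C S X (p @ q) Z))"
  proof (intro equalityI UN_least)
    fix p' q' assume "p' \<in> Collect (zz_eq C S X Y p)" "q' \<in> Collect (zz_eq C S Y Z q)"
    then show "snd (snd (zz_class C S X (p' @ q') Z)) \<subseteq> snd (snd (zz_class C S X (p @ q) Z))"
      using * by simp
  next
    show "snd (snd (zz_class C S X (p @ q) Z)) \<subseteq> (\<Union>p'\<in>Collect (zz_eq C S X Y p). \<Union>q'\<in>Collect (zz_eq C S Y Z q).
      snd (snd (zz_class C S X (p' @ q') Z)))"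
      using zz_eq_refl[of C S X Y p] zz_eq_refl[of C S Y Z q] by blast
  qed
  then show ?thesis by (simp add: Ho_def zz_class_conv)
qed

lemma category_Ho:
  assumes "category C"
  shows "category (Ho C S)"
  unfolding category_def
proof (intro conjI ballI impI)
  have Arr: "\<exists>p. zigzag C S (Dom (Ho C S) f) p (Cod (Ho C S) f) \<and>
      f = zz_class C S (Dom (Ho C S) f) p (Cod (Ho C S) f)" if "f \<in> Arr (Ho C S)" for f
    using Ho_homset[of f C S] that unfolding homset_def by blast
  fix f assume f: "f \<in> Arr (Ho C S)"
  then obtain p where p: "zigzag C S (Dom (Ho C S) f) p (Cod (Ho C S) f)"
      "f = zz_class C S (Dom (Ho C S) f) p (Cod (Ho C S) f)" using Arr by blast
  from zigzag_Obj[OF assms p(1)]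
  show ob: "Dom (Ho C S) f \<in> Obj (Ho C S)" "Cod (Ho C S) f \<in> Obj (Ho C S)" by auto
  show "f \<cdot>\<^bsub>Ho C S\<^esub> Idn (Ho C S) (Dom (Ho C S) f) = f"
    using Ho_comp[OF assms _ p(1), of "Dom (Ho C S) f" "[]"] p(2) ob by (simp add: Ho_Idn)
  show "Idn (Ho C S) (Cod (Ho C S) f) \<cdot>\<^bsub>Ho C S\<^esub> f = f"
    using Ho_comp[OF assms p(1), of "[]" "Cod (Ho C S) f"] p(2) ob by (simp add: Ho_Idn)
  fix g assume g: "g \<in> Arr (Ho C S)" and fg: "Cod (Ho C S) f = Dom (Ho C S) g"
  then obtain q where q: "zigzag C S (Dom (Ho C S) g) q (Cod (Ho C S) g)"
      "g = zz_class C S (Dom (Ho C S) g) q (Cod (Ho C S) g)" using Arr by blast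
  note q1 = q(1)[folded fg] and q2 = q(2)[folded fg]
  have pq: "zigzag C S (Dom (Ho C S) f) (p @ q) (Cod (Ho C S) g)"
    using p(1) q1 zigzag_append[OF assms] by blast
  have gf: "g \<cdot>\<^bsub>Ho C S\<^esub> f = zz_class C S (Dom (Ho C S) f) (p @ q) (Cod (Ho C S) g)"
    using Ho_comp[OF assms p(1) q1] p(2) q2 by simp
  then show "g \<cdot>\<^bsub>Ho C S\<^esub> f \<in> homset (Ho C S) (Dom (Ho C S) f) (Cod (Ho C S) g)"
    unfolding Ho_homset using pq by blast
  fix h assume h: "h \<in> Arr (Ho C S)" and gh: "Cod (Ho C S) g = Dom (Ho C S) h"
  then obtain t where t: "zigzag C S (Dom (Ho C S) h) t (Cod (Ho C S) h)"
      "h = zz_class C S (Dom (Ho C S) h) t (Cod (Ho C S) h)" using Arr by blast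
  note t1 = t(1)[folded gh] and t2 = t(2)[folded gh]
  have qt: "zigzag C S (Cod (Ho C S) f) (q @ t) (Cod (Ho C S) h)"
    using q1 t1 zigzag_append[OF assms] by blast
  show "h \<cdot>\<^bsub>Ho C S\<^esub> g \<cdot>\<^bsub>Ho C S\<^esub> f = h \<cdot>\<^bsub>Ho C S\<^esub> (g \<cdot>\<^bsub>Ho C S\<^esub> f)"
    using Ho_comp[OF assms pq t1] Ho_comp[OF assms q1 t1] Ho_comp[OF assms p(1) qt] gf p(2) q2 t2
    by simp
next
  fix X assume "X \<in> Obj (Ho C S)"
  then have "zigzag C S X [] X" by simp
  then show "Idn (Ho C S) X \<in> homset (Ho C S) X X"
    unfolding Ho_Idn Ho_homset by blast
qed

lemma zz_eq_Idn: "X \<in> Obj C \<Longrightarrow> category C \<Longrightarrow> zz_eq C S X X [Fwd (Idn C X)] []"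
  by (rule zz_eq_step) (auto intro: zz_step.intros simp: homsetD[OF Idn_homset])

lemma zz_eq_Comp:
  assumes "category C" "f \<in> homset C X Y" "g \<in> homset C Y Z"
  shows "zz_eq C S X Z [Fwd f, Fwd g] [Fwd (g \<cdot>\<^bsub>C\<^esub> f)]"
  using homset_Obj[OF assms(1,3)] homsetD[OF assms(2)] homsetD[OF assms(3)] homsetD[OF comp_homset[OF assms]]
  by (intro zz_eq_step zz_step.intros) auto

lemma zz_eq_Fwd_Bwd:
  assumes "category C" "w \<in> homset C X Y" "w \<in> weq S"
  shows "zz_eq C S X X [Fwd w, Bwd w] []"
  using homset_Obj[OF assms(1,2)] homsetD[OF assms(2)] assms(3)
  by (intro zz_eq_step zz_step.intros) auto

lemma zz_eq_Bwd_Fwd: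
  assumes "category C" "w \<in> homset C X Y" "w \<in> weq S"
  shows "zz_eq C S Y Y [Bwd w, Fwd w] []"
  using homset_Obj[OF assms(1,2)] homsetD[OF assms(2)] assms(3)
  by (intro zz_eq_step zz_step.intros) auto

lemma zigzag_Fwd:
  assumes "category C" "f \<in> homset C X Y"
  shows "zigzag C S X [Fwd f] Y"
  using homset_Obj[OF assms] homsetD[OF assms(2)] by auto

lemma zigzag_Bwd:
  assumes "category C" "w \<in> homset C X Y" "w \<in> weq S"
  shows "zigzag C S Y [Bwd w] X"
  using homset_Obj[OF assms(1,2)] homsetD[OF assms(2)] assms(3) by auto

lemma zz_eq_slide_Fwd:
  assumes "category C" "f \<in> homset C X Y" "v \<in> homset C Y Y'" "u \<in> homset C X X'" "g \<in> homset C X' Y'"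
    and "v \<cdot>\<^bsub>C\<^esub> f = g \<cdot>\<^bsub>C\<^esub> u"
  shows "zz_eq C S X Y' [Fwd f, Fwd v] [Fwd u, Fwd g]"
  by (rule zz_eq_trans[OF zz_eq_Comp[OF assms(1-3), unfolded assms(6)] zz_eq_sym[OF zz_eq_Comp[OF assms(1,4,5)]]])

text \<open>A commutative square moves a forward step past a backward step. Together with the forward
  version this is how naturality squares are used in zigzags.\<close>

lemma zz_eq_slide_Bwd:
  assumes "category C" "w \<in> homset C X Y" "w \<in> weq S" "w' \<in> homset C X' Y'" "w' \<in> weq S"
    and "u \<in> homset C X X'" "v \<in> homset C Y Y'" "v \<cdot>\<^bsub>C\<^esub> w = w' \<cdot>\<^bsub>C\<^esub> u"
  shows "zz_eq C S Y X' [Fwd v, Bwd w'] [Bwd w, Fwd u]"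
proof -
  note cat = assms(1)
  note z = zigzag_Fwd[OF cat assms(6)] zigzag_Fwd[OF cat assms(7)] zigzag_Bwd[OF cat assms(2,3)]
    zigzag_Bwd[OF cat assms(4,5)] zigzag_Fwd[OF cat assms(2)] zigzag_Fwd[OF cat assms(4)]
  have vw': "zigzag C S Y [Fwd v, Bwd w'] X'" and wu: "zigzag C S Y [Bwd w, Fwd u] X'"
    using z(1-4) zigzag_append[OF cat, of S Y "[Fwd v]" "[Bwd w']"]
      zigzag_append[OF cat, of S Y "[Bwd w]" "[Fwd u]"] by auto
  have ob: "X \<in> Obj C" "Y \<in> Obj C" "X' \<in> Obj C" "Y' \<in> Obj C"
    using homset_Obj[OF cat assms(2)] homset_Obj[OF cat assms(4)] by auto
  have "zz_eq C S Y X' ([] @ [Fwd v, Bwd w']) ([Bwd w, Fwd w] @ [Fwd v, Bwd w'])"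
    by (rule zz_eq_append[OF cat zz_eq_sym[OF zz_eq_Bwd_Fwd[OF cat assms(2,3)]] zz_eq_refl _ vw'])
      (use ob in simp)
  also have "zz_eq C S Y X' ([Bwd w, Fwd w] @ [Fwd v, Bwd w']) ([Bwd w] @ [Fwd u, Fwd w'] @ [Bwd w'])"
    using zz_eq_context[OF cat zz_eq_slide_Fwd[OF cat assms(2,7,6,4,8)] z(3,4)] by simp
  also have "zz_eq C S Y X' ([Bwd w] @ [Fwd u, Fwd w'] @ [Bwd w']) ([Bwd w, Fwd u] @ [])"
    using zz_eq_append[OF cat zz_eq_refl zz_eq_Fwd_Bwd[OF cat assms(4,5)] wu] z(4,6) ob
      zigzag_append[OF cat, of S X' "[Fwd w']" "[Bwd w']" X'] by simp
  finally show ?thesis by simp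
qed

fun reverse_step :: "'m step \<Rightarrow> 'm step" where
  "reverse_step (Fwd f) = Bwd f"
| "reverse_step (Bwd f) = Fwd f"

text \<open>Zigzags of this kind represent isomorphisms of the homotopy category, inverted by reversal,
  and join weakly equivalent objects.\<close>

definition weq_path :: "'m mstruct \<Rightarrow> 'm step list \<Rightarrow> bool" where
  "weq_path S p \<longleftrightarrow> set p \<subseteq> Fwd ` weq S \<union> Bwd ` weq S"

lemma weq_path_reverse:
  assumes "category C" "zigzag C S X p Y" "weq_path S p"
  shows "zigzag C S Y (rev (map reverse_step p)) X \<and> weq_path S (rev (map reverse_step p)) \<and>
    zz_eq C S X X (p @ rev (map reverse_step p)) []"
  using assms(2,3)
proof (induction p arbitrary: X)
  case Nil
  then show ?case by (auto simp: zz_eq_refl weq_path_def)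
next
  case (Cons s p)
  obtain X' where s: "zigzag C S X [s] X'" "zigzag C S X' p Y"
    using Cons.prems(1) zigzag_append[OF assms(1), of S X "[s]" p Y] by auto
  have rs: "zigzag C S X' [reverse_step s] X \<and> weq_path S [reverse_step s] \<and> zz_eq C S X X ([s] @ [reverse_step s]) []"
  proof (cases s)
    case (Fwd f)
    then have f: "f \<in> homset C X X'" "f \<in> weq S" using s(1) Cons.prems(2) by (auto simp: homset_def weq_path_def)
    then show ?thesis using Fwd homset_Obj[OF assms(1) f(1)] zz_eq_Fwd_Bwd[OF assms(1) f] zigzag_Bwd[OF assms(1) f] by (simp add: weq_path_def)
  next
    case (Bwd f)
    then have f: "f \<in> homset C X' X" "f \<in> weq S" using s(1) Cons.prems(2) by (auto simp: homset_def weq_path_def)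
    then show ?thesis using Bwd homset_Obj[OF assms(1) f(1)] zz_eq_Bwd_Fwd[OF assms(1) f] zigzag_Fwd[OF assms(1) f(1)] by (simp add: weq_path_def)
  qed
  have IH: "zigzag C S Y (rev (map reverse_step p)) X' \<and> weq_path S (rev (map reverse_step p)) \<and>
    zz_eq C S X' X' (p @ rev (map reverse_step p)) []"
    by (rule Cons.IH[OF s(2)]) (use Cons.prems(2) in \<open>simp add: weq_path_def\<close>)
  have "zz_eq C S X X ([s] @ (p @ rev (map reverse_step p)) @ [reverse_step s]) ([s] @ [] @ [reverse_step s])"
    by (rule zz_eq_context[OF assms(1) _ s(1)]) (use IH rs in blast)+
  also have "zz_eq C S X X ([s] @ [] @ [reverse_step s]) []" using rs by simp
  finally have "zz_eq C S X X ((s # p) @ rev (map reverse_step (s # p))) []" by simp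
  moreover have "zigzag C S Y (rev (map reverse_step (s # p))) X"
    using IH rs zigzag_append[OF assms(1), of S Y "rev (map reverse_step p)" "[reverse_step s]" X] by auto
  moreover have "weq_path S (rev (map reverse_step (s # p)))"
    using IH rs by (simp add: weq_path_def)
  ultimately show ?case by blast
qed

lemma iso_arr_weq_path:
  assumes "category C" "zigzag C S X p Y" "weq_path S p"
  shows "iso_arr (Ho C S) (zz_class C S X p Y)"
proof -
  let ?q = "rev (map reverse_step p)"
  note q = weq_path_reverse[OF assms]
  have "reverse_step (reverse_step s) = s" for s :: "'b step" by (cases s) auto
  then have "rev (map reverse_step ?q) = p" by (simp add: rev_map o_def)
  with weq_path_reverse[OF assms(1), of S Y ?q X] q have e: "zz_eq C S Y Y (?q @ p) []" by auto
  have h: "zz_class C S X p Y \<in> homset (Ho C S) X Y" "zz_class C S Y ?q X \<in> homset (Ho C S) Y X"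
    using assms(2) q unfolding Ho_homset by blast+
  have "zz_class C S Y ?q X \<cdot>\<^bsub>Ho C S\<^esub> zz_class C S X p Y = Idn (Ho C S) X"
    unfolding Ho_comp[OF assms(1,2) q[THEN conjunct1]] Ho_Idn
    by (rule zz_class_eqI) (use q in blast)
  moreover have "zz_class C S X p Y \<cdot>\<^bsub>Ho C S\<^esub> zz_class C S Y ?q X = Idn (Ho C S) Y"
    unfolding Ho_comp[OF assms(1) q[THEN conjunct1] assms(2)] Ho_Idn
    by (rule zz_class_eqI) (rule e)
  ultimately show ?thesis
    unfolding iso_arr_def homsetD(2,3)[OF h(1)] using homsetD(1)[OF h(1)] h(2) by blast
qed

lemma weakly_equivalent_weq_path:
  assumes "category C" "zigzag C S X p Y" "weq_path S p"
  shows "weakly_equivalent C S X Y"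
  using assms(2,3)
proof (induction p arbitrary: X)
  case Nil
  then show ?case by (auto simp: weakly_equivalent_def)
next
  case (Cons s p)
  obtain X' where s: "zigzag C S X [s] X'" "zigzag C S X' p Y"
    using Cons.prems(1) zigzag_append[OF assms(1), of S X "[s]" p Y] by auto
  have "(X, X') \<in> (\<Union>w\<in>weq S. {(Dom C w, Cod C w), (Cod C w, Dom C w)})"
    using s(1) Cons.prems(2) by (cases s) (auto simp: weq_path_def)
  moreover have "weakly_equivalent C S X' Y" using Cons.IH[OF s(2)] Cons.prems(2) by (simp add: weq_path_def)
  ultimately have "(X, Y) \<in> (\<Union>w\<in>weq S. {(Dom C w, Cod C w), (Cod C w, Dom C w)})\<^sup>*"
    unfolding weakly_equivalent_def by (rule converse_rtrancl_into_rtrancl[OF _ conjunct2[OF conjunct2]])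
  then show ?case
    using zigzag_Obj[OF assms(1) Cons.prems(1)] unfolding weakly_equivalent_def by (simp only: simp_thms)
qed

lemma ho_proj_farr: "f \<in> homset C X Y \<Longrightarrow> farr (ho_proj C S) f = zz_class C S X [Fwd f] Y"
  by (simp add: ho_proj_def homset_def)

lemma functor_ho_proj:
  assumes "category C"
  shows "is_functor C (Ho C S) (ho_proj C S)"
proof (rule functorI)
  show "category C" "category (Ho C S)" using assms category_Ho by auto
  show "fobj (ho_proj C S) X \<in> Obj (Ho C S)" if "X \<in> Obj C" for X
    using that by (simp add: ho_proj_def)
  show "farr (ho_proj C S) f \<in> homset (Ho C S) (fobj (ho_proj C S) X) (fobj (ho_proj C S) Y)"
    if "f \<in> homset C X Y" for f X Y
    unfolding ho_proj_farr[OF that] Ho_homset using zigzag_Fwd[OF assms that]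
    by (intro exI[of _ "[Fwd f]"] conjI) (simp_all only: ho_proj_def func.select_convs)
  show "farr (ho_proj C S) (Idn C X) = Idn (Ho C S) (fobj (ho_proj C S) X)" if "X \<in> Obj C" for X
    using zz_class_eqI[OF zz_eq_Idn[OF that assms]] Idn_homset[OF assms that]
    by (simp add: ho_proj_farr Ho_Idn) (simp add: ho_proj_def)
  fix f g X Y Z assume fg: "f \<in> homset C X Y" "g \<in> homset C Y Z"
  show "farr (ho_proj C S) (g \<cdot>\<^bsub>C\<^esub> f) = farr (ho_proj C S) g \<cdot>\<^bsub>Ho C S\<^esub> farr (ho_proj C S) f"
    using Ho_comp[OF assms zigzag_Fwd[OF assms fg(1)] zigzag_Fwd[OF assms fg(2)]]
      zz_class_eqI[OF zz_eq_Comp[OF assms fg]]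
    by (simp add: ho_proj_farr[OF fg(1)] ho_proj_farr[OF fg(2)] ho_proj_farr[OF comp_homset[OF assms fg]])
qed

lemma zigzag_map:
  assumes "is_functor C D F" "farr F ` weq S \<subseteq> weq S'" "zigzag C S X p Y"
  shows "zigzag D S' (fobj F X) (map (map_step (farr F)) p) (fobj F Y)"
  using assms(3)
proof (induction p arbitrary: X)
  case Nil
  then show ?case using functor_Obj[OF assms(1)] by auto
next
  case (Cons s p)
  have "farr F f \<in> Arr D" "Dom D (farr F f) = fobj F (Dom C f)" "Cod D (farr F f) = fobj F (Cod C f)"
    if "f \<in> Arr C" for f
    using functor_homset[OF assms(1) homsetI[OF that refl refl]] by (simp_all add: homset_def)
  with Cons assms(2) show ?case by (cases s) auto
qed

text \<open>A functor that preserves weak equivalences sends each generating relation to a generating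
  relation, so that the union over representatives in \<open>ho_map\<close> is a union of equal sets.\<close>

lemma zz_eq_map:
  assumes F: "is_functor C D F" "farr F ` weq S \<subseteq> weq S'" and "zz_eq C S X Y p p'"
  shows "zz_eq D S' (fobj F X) (fobj F Y) (map (map_step (farr F)) p) (map (map_step (farr F)) p')"
  using assms(3)
proof (induction rule: zz_eq_image_induct[where F = "map (map_step (farr F))"])
  case (step p p')
  then obtain c d s t where *: "p = c @ s @ d" "p' = c @ t @ d" "zz_step C S s t"
      "zigzag C S X p Y" "zigzag C S X p' Y"
    unfolding zz_rel_def by blast
  have "zz_step D S' (map (map_step (farr F)) s) (map (map_step (farr F)) t)"
    using *(3)
  proof cases
    case (1 X)
    then show ?thesis using functor_Idn[OF F(1)] functor_Obj[OF F(1)] by (auto intro: zz_step.intros)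
  next
    case (2 f g)
    have h: "f \<in> homset C (Dom C f) (Dom C g)" "g \<in> homset C (Dom C g) (Cod C g)"
      using 2 by (simp_all add: homset_def)
    show ?thesis
      using zz_step.intros(2)[of "farr F f" D "farr F g" S'] functor_homset[OF F(1) h(1)]
        functor_homset[OF F(1) h(2)] functor_comp[OF F(1) h] 2 by (simp add: homset_def)
  qed (use F(2) in \<open>auto intro: zz_step.intros\<close>)
  moreover note zigzag_map[OF F *(4)] zigzag_map[OF F *(5)]
  ultimately have "(map (map_step (farr F)) p, map (map_step (farr F)) p') \<in> zz_rel D S' (fobj F X) (fobj F Y)"
    using *(1,2) by (auto intro: zz_relI)
  then show ?case unfolding zz_eq_def by auto
qed

lemma ho_map_zz_class:
  assumes "is_functor C D F" "farr F ` weq S \<subseteq> weq S'"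
  shows "farr (ho_map D S' F) (zz_class C S X p Y) =
    zz_class D S' (fobj F X) (map (map_step (farr F)) p) (fobj F Y)"
proof -
  let ?m = "map (map_step (farr F))"
  let ?c = "\<lambda>p. snd (snd (zz_class D S' (fobj F X) (?m p) (fobj F Y)))"
  have "?c p' = ?c p" if "zz_eq C S X Y p p'" for p'
    by (simp only: zz_class_eqI[OF zz_eq_map[OF assms that]])
  then have "(\<Union>p'\<in>Collect (zz_eq C S X Y p). ?c p') = (\<Union>p'\<in>Collect (zz_eq C S X Y p). ?c p)"
    by (intro SUP_cong refl) (simp only: mem_Collect_eq)
  moreover have "Collect (zz_eq C S X Y p) \<noteq> {}" using zz_eq_refl[of C S X Y p] by blast
  ultimately have U: "(\<Union>p'\<in>Collect (zz_eq C S X Y p). ?c p') = ?c p"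
    by (simp only: UN_constant if_False)
  show ?thesis
    unfolding zz_class_conv[of C S X p Y] ho_map_def func.select_convs prod.case U
    by (simp add: zz_class_def)
qed


section \<open>The derived localization and its comparison zigzags\<close>

lemma functor_cong:
  assumes F: "is_functor C D F" and ob: "\<And>X. X \<in> Obj C \<Longrightarrow> fobj G X = fobj F X"
    and ar: "\<And>f X Y. f \<in> homset C X Y \<Longrightarrow> farr G f = farr F f"
  shows "is_functor C D G"
proof -
  have cat: "category C" "category D" using F unfolding is_functor_def by auto
  show ?thesis
  proof (rule functorI[OF cat])
    show "fobj G X \<in> Obj D" if "X \<in> Obj C" for X
      using functor_Obj[OF F that] ob[OF that] by simp
    show "farr G f \<in> homset D (fobj G X) (fobj G Y)" if "f \<in> homset C X Y" for f X Y
      using functor_homset[OF F that] ob homset_Obj[OF cat(1) that] ar[OF that] by simp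
    show "farr G (Idn C X) = Idn D (fobj G X)" if "X \<in> Obj C" for X
      using functor_Idn[OF F that] ob[OF that] ar[OF Idn_homset[OF cat(1) that]] by simp
    show "farr G (g \<cdot>\<^bsub>C\<^esub> f) = farr G g \<cdot>\<^bsub>D\<^esub> farr G f"
      if "f \<in> homset C X Y" "g \<in> homset C Y Z" for f g X Y Z
      using functor_comp[OF F that] ar[OF that(1)] ar[OF that(2)] ar[OF comp_homset[OF cat(1) that]]
      by simp
  qed
qed

text \<open>The derived functors of the identity, computed by a cofibrant replacement \<open>Q\<close> in \<open>S\<close> and a
  fibrant replacement \<open>R\<close> in \<open>S'\<close>.\<close>

locale derived_localization = localized \<kappa> C S S'
  for \<kappa> :: "'u rel" and C :: "('o, 'm) cat" and S S' :: "'m mstruct" +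
  fixes Q R :: "('o, 'm, 'o, 'm) func" and q r :: "'o \<Rightarrow> 'm"
  assumes Qrep: "cofibrant_replacement C S Q q"
    and Rrep: "fibrant_replacement C S' R r"
    and weq_sub: "weq S \<subseteq> weq S'"
begin

lemmas cat = base.cat

lemma Qfun: "is_functor C C Q" and Rfun: "is_functor C C R"
  using Qrep Rrep unfolding cofibrant_replacement_def fibrant_replacement_def nat_trans_def by auto

lemma q: "X \<in> Obj C \<Longrightarrow> q X \<in> homset C (fobj Q X) X" "X \<in> Obj C \<Longrightarrow> q X \<in> fib S \<inter> weq S"
  and q_square: "f \<in> homset C X Y \<Longrightarrow> f \<cdot>\<^bsub>C\<^esub> q X = q Y \<cdot>\<^bsub>C\<^esub> farr Q f"
  using Qrep nat_trans_homset[of C C Q id_func q X] nat_trans_square[of C C Q id_func q f X Y]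
  unfolding cofibrant_replacement_def by (auto simp: id_func_def)

lemma r: "X \<in> Obj C \<Longrightarrow> r X \<in> homset C X (fobj R X)" "X \<in> Obj C \<Longrightarrow> r X \<in> weq S'"
    "X \<in> Obj C \<Longrightarrow> fibrant C S' (fobj R X)"
  and r_square: "f \<in> homset C X Y \<Longrightarrow> farr R f \<cdot>\<^bsub>C\<^esub> r X = r Y \<cdot>\<^bsub>C\<^esub> f"
  using Rrep nat_trans_homset[of C C id_func R r X] nat_trans_square[of C C id_func R r f X Y]
  unfolding fibrant_replacement_def by (auto simp: id_func_def)

lemma Q_weq:
  assumes "f \<in> weq S'"
  shows "farr Q f \<in> weq S'"
proof -
  have f: "f \<in> homset C (Dom C f) (Cod C f)" using assms loc.weq_Arr by (auto simp: homset_def)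
  note X = homset_Obj[OF cat f]
  have "q (Cod C f) \<cdot>\<^bsub>C\<^esub> farr Q f \<in> weq S'"
    using two_of_three_comp[OF loc.weq23 q(1)[OF X(1)] f] q(2)[OF X(1)] assms weq_sub
      q_square[OF f] by auto
  then show ?thesis
    using two_of_three_right[OF loc.weq23 functor_homset[OF Qfun f] q(1)[OF X(2)]] q(2)[OF X(2)] weq_sub
    by auto
qed

lemma R_weq:
  assumes "f \<in> weq S'"
  shows "farr R f \<in> weq S"
proof -
  have f: "f \<in> homset C (Dom C f) (Cod C f)" using assms loc.weq_Arr by (auto simp: homset_def)
  note X = homset_Obj[OF cat f] and Rf = functor_homset[OF Rfun f]
  have "farr R f \<cdot>\<^bsub>C\<^esub> r (Dom C f) \<in> weq S'"
    using two_of_three_comp[OF loc.weq23 f r(1)[OF X(2)] assms r(2)[OF X(2)]] r_square[OF f] by simp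
  then have "farr R f \<in> weq S'"
    using two_of_three_left[OF loc.weq23 r(1)[OF X(1)] Rf r(2)[OF X(1)]] by simp
  then show ?thesis using weq_between_fibrant[OF Rf] r(3) X by simp
qed

text \<open>Cofibrant replacement in \<open>S\<close> preserves fibrancy in \<open>S'\<close>, because \<open>q Y\<close> is a trivial
  fibration in both structures. So the localization of an object that is already local does not
  change it.\<close>

lemma r_weq_of_fibrant:
  assumes "fibrant C S' Y"
  shows "r (fobj Q Y) \<in> weq S"
proof -
  have Y: "Y \<in> Obj C" using assms unfolding fibrant_def by blast
  note QY = functor_Obj[OF Qfun Y]
  have "q Y \<in> fib S'" using q(2)[OF Y] tfib_eq by blast
  then have "fibrant C S' (fobj Q Y)" using loc.fibrant_fib[OF q(1)[OF Y] _ assms] by simp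
  then show ?thesis using weq_between_fibrant[OF r(1,2)[OF QY] _ r(3)[OF QY]] by simp
qed

abbreviation Loc_obj :: "'o \<Rightarrow> 'o" where
  "Loc_obj X \<equiv> fobj R (fobj Q X)"

abbreviation Loc_arr :: "'m \<Rightarrow> 'm" where
  "Loc_arr f \<equiv> farr R (farr Q f)"

lemma Loc_homset: "f \<in> homset C X Y \<Longrightarrow> Loc_arr f \<in> homset C (Loc_obj X) (Loc_obj Y)"
  using functor_homset[OF Rfun functor_homset[OF Qfun]] .

lemma Loc_weq: "f \<in> weq S' \<Longrightarrow> Loc_arr f \<in> weq S"
  using R_weq Q_weq by blast

lemma Loc_proj_fobj: "fobj (localization_functor C S S' Q R \<circ>\<^sub>F ho_proj C S) X = Loc_obj X"
  by (simp add: localization_functor_def comp_func_def ho_map_def ho_proj_def)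

lemma Loc_proj_farr:
  assumes "f \<in> homset C X Y"
  shows "farr (localization_functor C S S' Q R \<circ>\<^sub>F ho_proj C S) f =
    zz_class C S (Loc_obj X) [Fwd (Loc_arr f)] (Loc_obj Y)"
proof -
  have Q: "farr Q ` weq S \<subseteq> weq S'" and R: "farr R ` weq S' \<subseteq> weq S"
    using Q_weq R_weq weq_sub by blast+
  show ?thesis
    using ho_map_zz_class[OF Qfun Q, of X "[Fwd f]" Y]
      ho_map_zz_class[OF Rfun R, of "fobj Q X" "[Fwd (farr Q f)]" "fobj Q Y"]
    by (simp add: localization_functor_def comp_func_def ho_proj_farr[OF assms])
qed

lemma functor_Loc_proj: "is_functor C (Ho C S) (localization_functor C S S' Q R \<circ>\<^sub>F ho_proj C S)"
proof (rule functor_cong)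
  show "is_functor C (Ho C S) (ho_proj C S \<circ>\<^sub>F (R \<circ>\<^sub>F Q))"
    by (rule comp_functor[OF comp_functor[OF Qfun Rfun] functor_ho_proj[OF cat]])
  show "fobj (localization_functor C S S' Q R \<circ>\<^sub>F ho_proj C S) X = fobj (ho_proj C S \<circ>\<^sub>F (R \<circ>\<^sub>F Q)) X" for X
    unfolding Loc_proj_fobj by (simp add: comp_func_def ho_proj_def)
  show "farr (localization_functor C S S' Q R \<circ>\<^sub>F ho_proj C S) f = farr (ho_proj C S \<circ>\<^sub>F (R \<circ>\<^sub>F Q)) f"
    if "f \<in> homset C X Y" for f X Y
    unfolding Loc_proj_farr[OF that] using ho_proj_farr[OF Loc_homset[OF that]]
    by (simp add: comp_func_def)
qed

text \<open>For a local equivalence \<open>g : X \<rightarrow> Y\<close> into a local object, the zigzag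
  \<open>Y \<leftarrow> Q Y \<rightarrow> R (Q Y) \<leftarrow> R (Q X)\<close> identifies \<open>Y\<close> with its own localization and that with the
  localization of \<open>X\<close>.\<close>

definition comparison :: "'o \<Rightarrow> 'm \<Rightarrow> 'm step list" where
  "comparison Y g = [Bwd (q Y), Fwd (r (fobj Q Y)), Bwd (Loc_arr g)]"

lemma comparison_zigzag:
  assumes g: "g \<in> homset C X Y" "g \<in> weq S'" and "fibrant C S' Y"
  shows "zigzag C S Y (comparison Y g) (Loc_obj X)" "weq_path S (comparison Y g)"
  using homset_Obj[OF cat g(1)] homsetD[OF q(1)] homsetD[OF r(1)] homsetD[OF Loc_homset[OF g(1)]]
    q(2) r_weq_of_fibrant[OF assms(3)] Loc_weq[OF g(2)] functor_Obj[OF Qfun] functor_Obj[OF Rfun]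
  by (auto simp: comparison_def weq_path_def)

text \<open>Naturality of the unit \<open>X \<leftarrow> Q X \<rightarrow> R (Q X)\<close>, from the naturality squares of \<open>q\<close> and
  \<open>r\<close>.\<close>

lemma zz_eq_q_r:
  assumes "f \<in> homset C X Y"
  shows "zz_eq C S X (Loc_obj Y) [Fwd f, Bwd (q Y), Fwd (r (fobj Q Y))]
    [Bwd (q X), Fwd (r (fobj Q X)), Fwd (Loc_arr f)]"
proof -
  note X = homset_Obj[OF cat assms] and Qf = functor_homset[OF Qfun assms]
  note QX = functor_Obj[OF Qfun X(1)] and QY = functor_Obj[OF Qfun X(2)]
  have qX: "q X \<in> weq S" and qY: "q Y \<in> weq S" using q(2) X by auto
  have "zz_eq C S X (Loc_obj Y) ([] @ [Fwd f, Bwd (q Y)] @ [Fwd (r (fobj Q Y))])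
      ([] @ [Bwd (q X), Fwd (farr Q f)] @ [Fwd (r (fobj Q Y))])"
    by (rule zz_eq_context[OF cat zz_eq_slide_Bwd[OF cat q(1)[OF X(1)] qX q(1)[OF X(2)] qY Qf assms
          q_square[OF assms]] _ zigzag_Fwd[OF cat r(1)[OF QY]]]) (simp add: X)
  also have "zz_eq C S X (Loc_obj Y) ([] @ [Bwd (q X), Fwd (farr Q f)] @ [Fwd (r (fobj Q Y))])
      ([Bwd (q X)] @ [Fwd (r (fobj Q X)), Fwd (Loc_arr f)] @ [])"
    using zz_eq_context[OF cat zz_eq_slide_Fwd[OF cat Qf r(1)[OF QY] r(1)[OF QX] Loc_homset[OF assms]
          r_square[OF Qf, symmetric]] zigzag_Bwd[OF cat q(1)[OF X(1)] qX], of "[]"] functor_Obj[OF Rfun QY]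
    by simp
  finally show ?thesis by simp
qed

text \<open>Sliding \<open>g\<close> past the unit turns it into \<open>R (Q g)\<close>, which cancels against the last step of
  the comparison zigzag.\<close>

lemma comparison_unit:
  assumes g: "g \<in> homset C X Y" "g \<in> weq S'"
  shows "zz_eq C S X (Loc_obj X) (Fwd g # comparison Y g) [Bwd (q X), Fwd (r (fobj Q X))]"
proof -
  note X = homset_Obj[OF cat g(1)] and Lg = Loc_homset[OF g(1)]
  note QX = functor_Obj[OF Qfun X(1)]
  have z: "zigzag C S X [Bwd (q X), Fwd (r (fobj Q X))] (Loc_obj X)"
    using homsetD[OF q(1)[OF X(1)]] q(2)[OF X(1)] homsetD[OF r(1)[OF QX]] functor_Obj[OF Rfun QX] by simp
  have "zz_eq C S X (Loc_obj X) ([] @ [Fwd g, Bwd (q Y), Fwd (r (fobj Q Y))] @ [Bwd (Loc_arr g)])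
      ([] @ [Bwd (q X), Fwd (r (fobj Q X)), Fwd (Loc_arr g)] @ [Bwd (Loc_arr g)])"
    by (rule zz_eq_context[OF cat zz_eq_q_r[OF g(1)] _ zigzag_Bwd[OF cat Lg Loc_weq[OF g(2)]]])
      (simp add: X)
  also have "zz_eq C S X (Loc_obj X) ([] @ [Bwd (q X), Fwd (r (fobj Q X)), Fwd (Loc_arr g)] @ [Bwd (Loc_arr g)])
      ([Bwd (q X), Fwd (r (fobj Q X))] @ [] @ [])"
    using zz_eq_context[OF cat zz_eq_Fwd_Bwd[OF cat Lg Loc_weq[OF g(2)]] z, of "[]"]
      functor_Obj[OF Rfun QX] by simp
  finally show ?thesis by (simp add: comparison_def)
qed

lemma comparison_natural:
  assumes g: "g \<in> homset C X Y" "g \<in> weq S'" and g': "g' \<in> homset C X' Y'" "g' \<in> weq S'"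
    and u: "u \<in> homset C X X'" and v: "v \<in> homset C Y Y'" and e: "v \<cdot>\<^bsub>C\<^esub> g = g' \<cdot>\<^bsub>C\<^esub> u"
  shows "zz_eq C S Y (Loc_obj X') (Fwd v # comparison Y' g') (comparison Y g @ [Fwd (Loc_arr u)])"
proof -
  note Y = homset_Obj[OF cat v] and Lg = Loc_homset[OF g(1)] and Lg' = Loc_homset[OF g'(1)]
  note QY = functor_Obj[OF Qfun Y(1)]
  have z: "zigzag C S Y [Bwd (q Y), Fwd (r (fobj Q Y))] (Loc_obj Y)"
    using homsetD[OF q(1)[OF Y(1)]] q(2)[OF Y(1)] homsetD[OF r(1)[OF QY]] functor_Obj[OF Rfun QY] by simp
  have "farr Q v \<cdot>\<^bsub>C\<^esub> farr Q g = farr Q g' \<cdot>\<^bsub>C\<^esub> farr Q u"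
    using functor_comp[OF Qfun g(1) v] functor_comp[OF Qfun u g'(1)] e by simp
  then have Le: "Loc_arr v \<cdot>\<^bsub>C\<^esub> Loc_arr g = Loc_arr g' \<cdot>\<^bsub>C\<^esub> Loc_arr u"
    using functor_comp[OF Rfun functor_homset[OF Qfun g(1)] functor_homset[OF Qfun v]]
      functor_comp[OF Rfun functor_homset[OF Qfun u] functor_homset[OF Qfun g'(1)]] by simp
  have "zz_eq C S Y (Loc_obj X') ([] @ [Fwd v, Bwd (q Y'), Fwd (r (fobj Q Y'))] @ [Bwd (Loc_arr g')])
      ([] @ [Bwd (q Y), Fwd (r (fobj Q Y)), Fwd (Loc_arr v)] @ [Bwd (Loc_arr g')])"
    by (rule zz_eq_context[OF cat zz_eq_q_r[OF v] _ zigzag_Bwd[OF cat Lg' Loc_weq[OF g'(2)]]])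
      (simp add: Y)
  also have "zz_eq C S Y (Loc_obj X') ([] @ [Bwd (q Y), Fwd (r (fobj Q Y)), Fwd (Loc_arr v)] @ [Bwd (Loc_arr g')])
      ([Bwd (q Y), Fwd (r (fobj Q Y))] @ [Bwd (Loc_arr g), Fwd (Loc_arr u)] @ [])"
    using zz_eq_context[OF cat zz_eq_slide_Bwd[OF cat Lg Loc_weq[OF g(2)] Lg' Loc_weq[OF g'(2)]
          Loc_homset[OF u] Loc_homset[OF v] Le] z, of "[]"] homset_Obj[OF cat Lg'] by simp
  finally show ?thesis by (simp add: comparison_def)
qed

end


section \<open>Fibrant replacement of algebras\<close>

lemma alg_homset:
  "\<phi> \<in> homset (alg_cat C T) E E' \<longleftrightarrow> (\<exists>f. \<phi> = (E, E', f) \<and> E \<in> algebras C T \<and> E' \<in> algebras C T \<and>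
     f \<in> homset C (fst E) (fst E') \<and> f \<cdot>\<^bsub>C\<^esub> snd E = snd E' \<cdot>\<^bsub>C\<^esub> farr (mfun T) f)"
  by (auto simp: homset_def alg_cat_def)

text \<open>Monadic functors create limits; for the terminal object, all algebra laws are equations
  between maps into a terminal object. The point is that the terminal algebra has a terminal
  underlying object, so that fibrant algebras have fibrant underlying objects.\<close>

lemma terminal_algebra:
  assumes "is_monad C T" "is_terminal C t"
  shows "\<exists>a. is_terminal (alg_cat C T) (t, a)"
proof -
  have \<eta>: "nat_trans C C id_func (mfun T) (munit T)"
    and \<mu>: "nat_trans C C (mfun T \<circ>\<^sub>F mfun T) (mfun T) (mmult T)"
    using assms(1) unfolding is_monad_def by simp_all
  have T: "is_functor C C (mfun T)" using \<eta> unfolding nat_trans_def by simp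
  then have cat: "category C" unfolding is_functor_def by simp
  have ex: "\<exists>f. f \<in> homset C X t" if "X \<in> Obj C" for X
    using assms(2) that unfolding is_terminal_def by (blast dest: ex1_implies_ex)
  have t: "t \<in> Obj C" using assms(2) unfolding is_terminal_def by blast
  have un: "f = g" if "f \<in> homset C X t" "g \<in> homset C X t" for f g X
    using assms(2) that homset_Obj[OF cat that(1)] unfolding is_terminal_def by blast
  obtain a where a: "a \<in> homset C (fobj (mfun T) t) t" using ex[OF functor_Obj[OF T t]] by blast
  have u: "munit T t \<in> homset C t (fobj (mfun T) t)"
    using nat_trans_homset[OF \<eta> t] by (simp add: id_func_def)
  have m: "mmult T t \<in> homset C (fobj (mfun T) (fobj (mfun T) t)) (fobj (mfun T) t)"
    using nat_trans_homset[OF \<mu> t] by (simp add: comp_func_def)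
  have alg: "(t, a) \<in> algebras C T"
    unfolding algebras_def
    using t a un[OF comp_homset[OF cat u a] Idn_homset[OF cat t]]
      un[OF comp_homset[OF cat m a] comp_homset[OF cat functor_homset[OF T a] a]] by simp
  have "is_terminal (alg_cat C T) (t, a)"
    unfolding is_terminal_def
  proof (intro conjI ballI)
    show "(t, a) \<in> Obj (alg_cat C T)" using alg by (simp add: alg_cat_def)
    fix E assume "E \<in> Obj (alg_cat C T)"
    then have E: "E \<in> algebras C T" by (simp add: alg_cat_def)
    then have X: "fst E \<in> Obj C" and e: "snd E \<in> homset C (fobj (mfun T) (fst E)) (fst E)"
      by (auto simp: algebras_def)
    obtain f where f: "f \<in> homset C (fst E) t" using ex[OF X] by blast
    have "f \<cdot>\<^bsub>C\<^esub> snd E = a \<cdot>\<^bsub>C\<^esub> farr (mfun T) f"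
      using un[OF comp_homset[OF cat e f] comp_homset[OF cat functor_homset[OF T f] a]] .
    then have "(E, (t, a), f) \<in> homset (alg_cat C T) E (t, a)"
      using E alg f by (auto simp: alg_homset)
    moreover have "\<phi> = (E, (t, a), f)" if "\<phi> \<in> homset (alg_cat C T) E (t, a)" for \<phi>
      using that un[OF _ f] by (auto simp: alg_homset)
    ultimately show "\<exists>!\<phi>. \<phi> \<in> homset (alg_cat C T) E (t, a)" by blast
  qed
  then show ?thesis by blast
qed

text \<open>Factoring the unique maps \<open>E \<rightarrow> t\<close> is functorial in \<open>E\<close>, as long as the factorization covers
  maps whose domain satisfies \<open>P\<close>. In a semi-model category this is the case for cofibrant
  domains.\<close>

lemma functorial_replacement:
  assumes cat: "category D" and fin: "is_terminal D t"
    and fact: "functorial_factorization D {f. P (Dom D f)} L F"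
  obtains G \<rho> where "nat_trans (full_subcat D {E. P E}) D id_func G \<rho>"
    and "\<And>E. E \<in> Obj D \<Longrightarrow> P E \<Longrightarrow> \<rho> E \<in> L"
    and "\<And>E. E \<in> Obj D \<Longrightarrow> P E \<Longrightarrow> \<exists>f\<in>homset D (fobj G E) t. f \<in> F"
proof -
  let ?A = "arrow_cat D {f. P (Dom D f)}" and ?D = "full_subcat D {E. P E}"
  obtain Z l r where l: "nat_trans ?A D (dom_func D) Z l"
    and r: "nat_trans ?A D Z (cod_func D) r"
    and f: "\<forall>f\<in>Arr D \<inter> {f. P (Dom D f)}. l f \<in> L \<and> r f \<in> F \<and> r f \<cdot>\<^bsub>D\<^esub> l f = f"
    using fact unfolding functorial_factorization_def by blast
  have Z: "is_functor ?A D Z" and catA: "category ?A"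
    using l unfolding nat_trans_def is_functor_def by blast+
  define b where "b X = (THE f. f \<in> homset D X t)" for X
  have b: "b X \<in> homset D X t" if "X \<in> Obj D" for X
    using fin that theI'[of "\<lambda>f. f \<in> homset D X t"] unfolding is_terminal_def b_def by blast
  have un: "f = g" if "f \<in> homset D X t" "g \<in> homset D X t" for f g X
    using fin that homset_Obj[OF cat that(1)] unfolding is_terminal_def by blast
  have t: "t \<in> Obj D" using fin unfolding is_terminal_def by blast
  note idt = Idn_homset[OF cat t]
  define H where "H = \<lparr>fobj = b, farr = \<lambda>f. (b (Dom D f), b (Cod D f), f, Idn D t)\<rparr>"
  have bA: "b X \<in> Obj ?A" if "X \<in> Obj ?D" for X
    using that b[of X] by (auto simp: arrow_cat_def full_subcat_Obj homset_def)
  have H: "is_functor ?D ?A H"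
  proof (rule functorI[OF category_full_subcat[OF cat] catA])
    show "fobj H X \<in> Obj ?A" if "X \<in> Obj ?D" for X
      using bA[OF that] by (simp add: H_def)
    show "farr H f \<in> homset ?A (fobj H X) (fobj H Y)" if "f \<in> homset ?D X Y" for f X Y
    proof -
      have fh: "f \<in> homset D X Y" "P X" "P Y" using that by (auto simp: full_subcat_homset)
      note X = homset_Obj[OF cat fh(1)]
      have "b Y \<cdot>\<^bsub>D\<^esub> f = Idn D t \<cdot>\<^bsub>D\<^esub> b X"
        using un[OF comp_homset[OF cat fh(1) b[OF X(2)]]] b[OF X(1)] comp_Idn[OF cat b[OF X(1)]] by simp
      then show ?thesis
        using fh homsetD[OF fh(1)] homsetD[OF b[OF X(1)]] homsetD[OF b[OF X(2)]] idt
        by (auto simp: H_def homset_def arrow_cat_def)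
    qed
    show "farr H (Idn ?D X) = Idn ?A (fobj H X)" if "X \<in> Obj ?D" for X
      using that homsetD[OF Idn_homset[OF cat, of X]] homsetD[OF b[of X]]
      by (auto simp: H_def arrow_cat_def full_subcat_ops full_subcat_Obj)
    show "farr H (g \<cdot>\<^bsub>?D\<^esub> f) = farr H g \<cdot>\<^bsub>?A\<^esub> farr H f"
      if "f \<in> homset ?D X Y" "g \<in> homset ?D Y Z" for f g X Y Z
    proof -
      have fg: "f \<in> homset D X Y" "g \<in> homset D Y Z" using that by (auto simp: full_subcat_homset)
      show ?thesis
        using homsetD[OF fg(1)] homsetD[OF fg(2)] homsetD[OF comp_homset[OF cat fg]] comp_Idn[OF cat idt]
        by (auto simp: H_def arrow_cat_def full_subcat_ops)
    qed
  qed
  have sub: "is_functor ?D D id_func"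
    by (rule functor_full_subcat) (auto simp: is_functor_def cat id_func_def homset_def)
  have "nat_trans ?D D id_func (Z \<circ>\<^sub>F H) (\<lambda>E. l (b E))"
  proof (rule nat_transI[OF sub comp_functor[OF H Z]])
    show "l (b X) \<in> homset D (fobj id_func X) (fobj (Z \<circ>\<^sub>F H) X)" if "X \<in> Obj ?D" for X
      using nat_trans_homset[OF l bA[OF that]] homsetD[OF b[of X]] that
      by (simp add: dom_func_def comp_func_def H_def id_func_def full_subcat_Obj)
    show "l (b Y) \<cdot>\<^bsub>D\<^esub> farr id_func f = farr (Z \<circ>\<^sub>F H) f \<cdot>\<^bsub>D\<^esub> l (b X)" if "f \<in> homset ?D X Y" for f X Y
      using nat_trans_square[OF l functor_homset[OF H that]]
      by (simp add: dom_func_def comp_func_def H_def id_func_def)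
  qed
  moreover have "l (b E) \<in> L" "\<exists>f\<in>homset D (fobj (Z \<circ>\<^sub>F H) E) t. f \<in> F" if E: "E \<in> Obj D" "P E" for E
  proof -
    have bE: "b E \<in> Obj ?A" using bA E by (simp add: full_subcat_Obj)
    have "r (b E) \<in> homset D (fobj (Z \<circ>\<^sub>F H) E) t"
      using nat_trans_homset[OF r bE] homsetD[OF b[OF E(1)]]
      by (simp add: cod_func_def comp_func_def H_def)
    then show "l (b E) \<in> L" "\<exists>f\<in>homset D (fobj (Z \<circ>\<^sub>F H) E) t. f \<in> F"
      using f homsetD[OF b[OF E(1)]] E(2) by auto
  qed
  ultimately show thesis using that by blast
qed


section \<open>Preservation of algebras\<close>

text \<open>The axioms of a semi-model category restrict the second lifting and factorization property
  to cofibrant domains, but the first pair is unrestricted, and this is what determines the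
  cofibrations.\<close>

lemma semi_model_cof_iff:
  assumes "semi_model_category \<kappa> C S D F U A"
  shows "f \<in> cof A \<longleftrightarrow> f \<in> Arr D \<and> (\<forall>p\<in>fib A \<inter> weq A. lifts D f p)"
proof -
  have *: "category D" "functorial_factorization D UNIV (cof A) (fib A \<inter> weq A)"
      "retract_closed D (cof A)" "cof A \<subseteq> Arr D" "\<forall>i\<in>cof A. \<forall>p\<in>fib A \<inter> weq A. lifts D i p"
    using assms unfolding semi_model_category_def by simp_all
  show ?thesis using retract_argument_left[OF *(1-3) _ UNIV_I, of f] *(4,5) by blast
qed

theorem theorem7p2p3:
  fixes \<kappa> :: "'u rel"
    and M :: "('o, 'm) cat"
    and S S\<^sub>L :: "'m mstruct"
    and \<C> :: "'m set"
    and Q R :: "('o, 'm, 'o, 'm) func"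
    and q r :: "'o \<Rightarrow> 'm"
    and T :: "('o, 'm) monad"
    and A A\<^sub>L :: "('o, 'm) alg_arr mstruct"
  assumes "universe \<kappa>"
    and "model_category \<kappa> M S"
    and "left_proper M S"
    and "small \<kappa> \<C>"
    and "\<C> \<subseteq> cof S"
    and "\<forall>g\<in>\<C>. cofibrant M S (Dom M g) \<and> cofibrant M S (Cod M g)"
    and "left_bousfield_localization \<kappa> M S \<C> S\<^sub>L"
    and "cofibrantly_generated \<kappa> M S\<^sub>L"
    and "cofibrant_replacement M S Q q"
    and "fibrant_replacement M S\<^sub>L R r"
    and "is_monad M T"
    and "projective_semi_model_structure \<kappa> M S T A"
    and "projective_semi_model_structure \<kappa> M S\<^sub>L T A\<^sub>L"
  shows "preserves_algebras M S S\<^sub>L Q q R r T A"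
proof -
  let ?D = "alg_cat M T" and ?U = "forget_func :: (('o, 'm) alg, ('o, 'm) alg_arr, 'o, 'm) func"
  have SL: "model_category \<kappa> M S\<^sub>L" "cof S\<^sub>L = cof S"
    using assms(7) unfolding left_bousfield_localization_def by blast+
  interpret derived_localization \<kappa> M S S\<^sub>L Q R q r
    by unfold_locales (fact assms(1,2,9,10) SL weq_local_equivalence[OF assms(2,7)])+
  have semi: "semi_model_category \<kappa> M S ?D (free_func M T) ?U A"
      "semi_model_category \<kappa> M S\<^sub>L ?D (free_func M T) ?U A\<^sub>L"
    and weqA: "weq A = {f \<in> Arr ?D. farr ?U f \<in> weq S}" "weq A\<^sub>L = {f \<in> Arr ?D. farr ?U f \<in> weq S\<^sub>L}"
    and fibA: "fib A = {f \<in> Arr ?D. farr ?U f \<in> fib S}" "fib A\<^sub>L = {f \<in> Arr ?D. farr ?U f \<in> fib S\<^sub>L}"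
    using assms(12,13) unfolding projective_semi_model_structure_def by simp_all
  have catD: "category ?D" and bicD: "bicomplete \<kappa> ?D" and adj: "adjunction M ?D (free_func M T) ?U"
    and factA: "functorial_factorization ?D UNIV (cof A) (fib A \<inter> weq A)"
    using semi(1) unfolding semi_model_category_def by simp_all
  have factL: "functorial_factorization ?D {f. cofibrant ?D A\<^sub>L (Dom ?D f)} (cof A\<^sub>L \<inter> weq A\<^sub>L) (fib A\<^sub>L)"
    using semi(2) unfolding semi_model_category_def by simp
  have U: "is_functor ?D M ?U" using adj unfolding adjunction_def by blast
  have "fib A \<inter> weq A = fib A\<^sub>L \<inter> weq A\<^sub>L"
    unfolding weqA fibA using tfib_eq by blast
  then have "cof A\<^sub>L = cof A"
    using semi_model_cof_iff[OF semi(1)] semi_model_cof_iff[OF semi(2)] by blast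
  then have cofib: "cofibrant ?D A\<^sub>L E \<longleftrightarrow> cofibrant ?D A E" for E
    unfolding cofibrant_def by simp
  (* The functorial replacement in the localized structure on algebras. *)
  obtain t where t: "is_terminal M t" using terminal_exists[OF assms(1) cat base.bicomp] by blast
  obtain a where a: "is_terminal ?D (t, a)" using terminal_algebra[OF assms(11) t] by blast
  let ?CA = "full_subcat ?D {E. cofibrant ?D A E}"
  obtain G \<rho> where G: "nat_trans ?CA ?D id_func G \<rho>"
    and \<rho>: "\<And>E. E \<in> Obj ?D \<Longrightarrow> cofibrant ?D A E \<Longrightarrow> \<rho> E \<in> cof A\<^sub>L \<inter> weq A\<^sub>L"
    and Gfib: "\<And>E. E \<in> Obj ?D \<Longrightarrow> cofibrant ?D A E \<Longrightarrow> \<exists>f\<in>homset ?D (fobj G E) (t, a). f \<in> fib A\<^sub>L"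
    using functorial_replacement[OF catD a factL] unfolding cofib by metis
  have Gfun: "is_functor ?CA ?D G" using G unfolding nat_trans_def by blast
  note UC = functor_full_subcat[OF U, of "{E. cofibrant ?D A E}"]
  have CA: "E \<in> Obj ?D" "cofibrant ?D A E" if "E \<in> Obj ?CA" for E
    using that by (auto simp: full_subcat_Obj)
  define g where "g E = farr ?U (\<rho> E)" for E
  have \<rho>h: "\<rho> E \<in> homset ?D E (fobj G E)" if "E \<in> Obj ?CA" for E
    using nat_trans_homset[OF G that] by (simp add: id_func_def)
  have gh: "g E \<in> homset M (fobj ?U E) (fobj ?U (fobj G E))" if "E \<in> Obj ?CA" for E
    unfolding g_def using functor_homset[OF U \<rho>h[OF that]] .
  have gw: "g E \<in> weq S\<^sub>L" if "E \<in> Obj ?CA" for E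
    using \<rho>[OF CA(1)[OF that] CA(2)[OF that]] weqA(2) by (simp add: g_def)
  have Gf: "fibrant M S\<^sub>L (fobj ?U (fobj G E))" if E: "E \<in> Obj ?CA" for E
  proof -
    obtain f where f: "f \<in> homset ?D (fobj G E) (t, a)" "f \<in> fib A\<^sub>L"
      using Gfib[OF CA(1)[OF E] CA(2)[OF E]] by blast
    have "farr ?U f \<in> homset M (fobj ?U (fobj G E)) t" "farr ?U f \<in> fib S\<^sub>L"
      using functor_homset[OF U f(1)] f(2) fibA(2) by (simp_all add: forget_func_def)
    then show ?thesis using t homset_Obj[OF cat] unfolding fibrant_def by blast
  qed
  let ?c = "\<lambda>E. comparison (fobj ?U (fobj G E)) (g E)"
  have zz: "zigzag M S (fobj ?U (fobj G E)) (?c E) (Loc_obj (fobj ?U E))" "weq_path S (?c E)"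
    if "E \<in> Obj ?CA" for E
    using comparison_zigzag[OF gh[OF that] gw[OF that] Gf[OF that]] .
  let ?Loc = "localization_functor M S S\<^sub>L Q R"
  have Loc_fobj: "fobj ?Loc X = Loc_obj X" for X
    by (simp add: localization_functor_def comp_func_def ho_map_def)
  define \<beta> where "\<beta> E = zz_class M S (fobj ?U (fobj G E)) (?c E) (Loc_obj (fobj ?U E))" for E
  let ?P = "ho_proj M S \<circ>\<^sub>F ?U \<circ>\<^sub>F G" and ?L = "?Loc \<circ>\<^sub>F ho_proj M S \<circ>\<^sub>F ?U"
  have P_fobj: "fobj ?P E = fobj ?U (fobj G E)" and L_fobj: "fobj ?L E = Loc_obj (fobj ?U E)" for E
    using Loc_proj_fobj by (simp_all add: comp_func_def ho_proj_def)
  have nat: "nat_trans ?CA (Ho M S) ?P ?L \<beta>"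
  proof (rule nat_transI)
    show "is_functor ?CA (Ho M S) ?P"
      by (rule comp_functor[OF Gfun comp_functor[OF U functor_ho_proj[OF cat]]])
    show "is_functor ?CA (Ho M S) ?L" by (rule comp_functor[OF UC functor_Loc_proj])
    show "\<beta> E \<in> homset (Ho M S) (fobj ?P E) (fobj ?L E)" if "E \<in> Obj ?CA" for E
      unfolding P_fobj L_fobj \<beta>_def Ho_homset using zz(1)[OF that] by blast
    fix f E E' assume f: "f \<in> homset ?CA E E'"
    have catCA: "category ?CA" using category_full_subcat[OF catD] .
    note E = homset_Obj[OF catCA f]
    have fD: "f \<in> homset ?D E E'" using f by (simp add: full_subcat_homset)
    note Uf = functor_homset[OF U fD] and UGf = functor_homset[OF U functor_homset[OF Gfun f]]
    have "\<rho> E' \<cdot>\<^bsub>?D\<^esub> f = farr G f \<cdot>\<^bsub>?D\<^esub> \<rho> E"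
      using nat_trans_square[OF G f] by (simp add: id_func_def)
    then have e: "farr ?U (farr G f) \<cdot>\<^bsub>M\<^esub> g E = g E' \<cdot>\<^bsub>M\<^esub> farr ?U f"
      using functor_comp[OF U fD \<rho>h[OF E(2)]] functor_comp[OF U \<rho>h[OF E(1)] functor_homset[OF Gfun f]]
      by (simp add: g_def)
    have P_farr: "farr ?P f = zz_class M S (fobj ?U (fobj G E)) [Fwd (farr ?U (farr G f))] (fobj ?U (fobj G E'))"
      using ho_proj_farr[OF UGf] by (simp add: comp_func_def)
    have L_farr: "farr ?L f = zz_class M S (Loc_obj (fobj ?U E)) [Fwd (Loc_arr (farr ?U f))] (Loc_obj (fobj ?U E'))"
      using Loc_proj_farr[OF Uf] by (simp add: comp_func_def)
    show "\<beta> E' \<cdot>\<^bsub>Ho M S\<^esub> farr ?P f = farr ?L f \<cdot>\<^bsub>Ho M S\<^esub> \<beta> E"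
      unfolding P_farr L_farr \<beta>_def Ho_comp[OF cat zigzag_Fwd[OF cat UGf] zz(1)[OF E(2)]]
        Ho_comp[OF cat zz(1)[OF E(1)] zigzag_Fwd[OF cat Loc_homset[OF Uf]]]
      using zz_class_eqI[OF comparison_natural[OF gh[OF E(1)] gw[OF E(1)] gh[OF E(2)] gw[OF E(2)] Uf UGf e]]
      by simp
  qed
  have unit: "\<beta> E \<cdot>\<^bsub>Ho M S\<^esub> farr (ho_proj M S \<circ>\<^sub>F ?U) (\<rho> E) = localization_map M S Q q R r (fobj ?U E)"
    if E: "E \<in> Obj ?CA" for E
  proof -
    have "farr (ho_proj M S \<circ>\<^sub>F ?U) (\<rho> E) = zz_class M S (fobj ?U E) [Fwd (g E)] (fobj ?U (fobj G E))"
      using ho_proj_farr[OF gh[OF E]] by (simp add: comp_func_def g_def)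
    then show ?thesis
      using zz_class_eqI[OF comparison_unit[OF gh[OF E] gw[OF E]]]
        Ho_comp[OF cat zigzag_Fwd[OF cat gh[OF E]] zz(1)[OF E]]
      by (simp add: \<beta>_def localization_map_def)
  qed
  have "\<exists>E'\<in>Obj ?D. weakly_equivalent M S (fobj ?U E') (fobj ?Loc (fobj ?U E))" if E: "E \<in> Obj ?D" for E
  proof -
    (* A cofibrant replacement p : E0 -> E of algebras over S. *)
    obtain i where i: "is_initial ?D i" using initial_exists[OF assms(1) catD bicD] by blast
    then obtain k where k: "k \<in> homset ?D i E"
      using E unfolding is_initial_def by (blast dest: ex1_implies_ex)
    obtain E0 l p where lp: "l \<in> homset ?D i E0" "p \<in> homset ?D E0 E" "l \<in> cof A" "p \<in> fib A \<inter> weq A"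
      using factorization[OF factA k UNIV_I] by metis
    have E0: "E0 \<in> Obj ?CA"
      using lp(1,3) i homset_Obj[OF catD lp(1)] unfolding full_subcat_Obj cofibrant_def mem_Collect_eq by blast
    note Up = functor_homset[OF U lp(2)]
    have pw: "Loc_arr (farr ?U p) \<in> weq S" using lp(4) weqA(1) weq_sub by (auto intro: Loc_weq)
    have "zigzag M S (fobj ?U (fobj G E0)) (?c E0 @ [Fwd (Loc_arr (farr ?U p))]) (Loc_obj (fobj ?U E))"
      using zz(1)[OF E0] zigzag_Fwd[OF cat Loc_homset[OF Up]] zigzag_append[OF cat] by blast
    moreover have "weq_path S (?c E0 @ [Fwd (Loc_arr (farr ?U p))])"
      using zz(2)[OF E0] pw by (simp add: weq_path_def)
    ultimately have "weakly_equivalent M S (fobj ?U (fobj G E0)) (Loc_obj (fobj ?U E))"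
      by (rule weakly_equivalent_weq_path[OF cat])
    then show ?thesis using functor_Obj[OF Gfun E0] by (auto simp: Loc_fobj)
  qed
  moreover have "weakly_equivalent M S (fobj ?U (fobj G E)) (fobj ?Loc (fobj ?U E)) \<and>
      iso_arr (Ho M S) (\<beta> E)" if "E \<in> Obj ?CA" for E
    using weakly_equivalent_weq_path[OF cat zz(1)[OF that] zz(2)[OF that]] iso_arr_weq_path[OF cat zz(1)[OF that] zz(2)[OF that]]
    by (simp add: \<beta>_def Loc_fobj)
  ultimately show ?thesis
    unfolding preserves_algebras_def Let_def using G nat unit by blast
qed

end
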